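(* Let $d\ge 1$, $T>0$, let $g:[0,\infty)\to\mathbb{R}$ be smooth and non-decreasing, and let $H:\mathbb{R}^d\to\mathbb{R}$ be smooth and convex. Let $u,m\in C^\infty(\mathbb{T}^d\times[0,T])$ with $m\ge 0$ (both periodic in $x$) solve the first-order mean-field game $$\begin{cases}-u_t+H(Du)=g(m),\\ m_t-\operatorname{div}\big(m\,D_pH(Du)\big)=0,\end{cases}\qquad (x,t)\in\mathbb{T}^d\times(0,T).$$ Let $U:[0,\infty)\to\mathbb{R}$ be a $C^1$ function and set $P(z)=U'(z)z-U(z)$. Assume that $P\in C^1([0,\infty))$, that $P(z)\ge 0$ for all $z\geq 0$, and that $z\mapsto \dfrac{P(z)}{z^{1-\frac1d}}$ is non-decreasing on $(0,\infty)$. Then the function $$t\mapsto\int_{\mathbb{T}^d}U(m(x,t))\,dx$$ is convex on $[0,T]$.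
   Context: $\mathbb{T}^d=\mathbb{R}^d/\mathbb{Z}^d$ is the $d$-dimensional flat torus (of Lebesgue measure $1$); functions on $\mathbb{T}^d$ are identified with $\mathbb{Z}^d$-periodic functions on $\mathbb{R}^d$. $D$ and $\operatorname{div}$ denote the gradient and divergence in the space variable $x$; the subscript $t$ denotes the time derivative; $D_pH$ is the gradient of $H=H(p)$. *)

theory Defs
  imports "HOL-Analysis.Analysis"
begin

text \<open>
  Functions of class $C^k$ on a set \<open>S\<close>, with derivatives taken within \<open>S\<close>, so that on sets with
  boundary such as $[0,\infty)$ or $\mathbb{R}^d\times[0,T]$ this is regularity up to the boundary
  (one-sided derivatives there). The definition is intended for sets on which derivatives are
  unique, e.g. convex sets with nonempty interior. Values outside \<open>S\<close> are irrelevant.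
\<close>

fun Ck_on :: "nat \<Rightarrow> 'a::euclidean_space set \<Rightarrow> ('a \<Rightarrow> 'b::real_normed_vector) \<Rightarrow> bool" where
  "Ck_on 0 S f \<longleftrightarrow> continuous_on S f"
| "Ck_on (Suc k) S f \<longleftrightarrow>
     (\<exists>f'. (\<forall>x\<in>S. (f has_derivative f' x) (at x within S)) \<and>
           (\<forall>b\<in>Basis. Ck_on k S (\<lambda>x. f' x b)))"

definition smooth_on :: "'a::euclidean_space set \<Rightarrow> ('a \<Rightarrow> 'b::real_normed_vector) \<Rightarrow> bool" where
  "smooth_on S f \<longleftrightarrow> (\<forall>k. Ck_on k S f)"

definition grad :: "(real ^ 'n \<Rightarrow> real) \<Rightarrow> real ^ 'n \<Rightarrow> real ^ 'n" where
  "grad f x = (\<chi> i. frechet_derivative f (at x) (axis i 1))"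

lemma grad_eq: "GDERIV f x :> D \<Longrightarrow> grad f x = D"
  by (auto simp: gderiv_def grad_def vec_eq_iff inner_axis inner_commute
      dest!: frechet_derivative_at[symmetric])

definition divergence :: "(real ^ 'n \<Rightarrow> real ^ 'n) \<Rightarrow> real ^ 'n \<Rightarrow> real" where
  "divergence F x = (\<Sum>i\<in>UNIV. frechet_derivative F (at x) (axis i 1) $ i)"

text \<open>Functions on the flat torus are represented by $\mathbb{Z}^d$-periodic functions on
  $\mathbb{R}^d$, integrated over the fundamental cell $[0,1]^d$.\<close>

definition Zd_periodic :: "(real ^ 'n \<Rightarrow> 'b) \<Rightarrow> bool" where
  "Zd_periodic f \<longleftrightarrow> (\<forall>x k. (\<forall>i. k $ i \<in> \<int>) \<longrightarrow> f (x + k) = f x)"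

definition torus_integral :: "(real ^ 'n \<Rightarrow> real) \<Rightarrow> real" where
  "torus_integral f = integral (cbox 0 1) f"

text \<open>The function $P(z) = U'(z)z - U(z)$ on $[0,\infty)$; at \<open>z = 0\<close> the derivative is
  one-sided.\<close>

definition pressure :: "(real \<Rightarrow> real) \<Rightarrow> real \<Rightarrow> real" where
  "pressure U z = vector_derivative U (at z within {0..}) * z - U z"

end

theory Submission
  imports Defs
begin

text \<open>
  Write $b = D_pH(Du)$, $\theta = \operatorname{div} b$, $A = D^2H(Du)$ and $P(z) = U'(z)z - U(z)$.
  The continuity equation $m_t = \operatorname{div}(mb)$ gives
  $\frac{d}{dt}\int U(m) = \int P(m)\,\theta$. Differentiating the Hamilton--Jacobi equation in
  space gives $b_t = (b\cdot D)b - A\,D(g(m))$, so that after a second integration by parts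
  $$\frac{d^2}{dt^2}\int U(m) = \int (m P'(m) - P(m))\,\theta^2 + P(m)\operatorname{tr}((Db)^2)
      + P'(m) g'(m)\, Dm\cdot A\,Dm.$$
  As $Db$ is the product of the positive semidefinite matrix $A$ and the symmetric matrix $D^2u$,
  $\operatorname{tr}((Db)^2) \ge \theta^2/d$, and the monotonicity of $P(z)/z^{1-1/d}$ amounts to
  $zP'(z) \ge (1-1/d)P(z)$; hence the integrand is nonnegative.
\<close>

section \<open>Calculus of smooth functions\<close>

text \<open>With \<open>U\<close> and P only of class C^1, U'' must not appear. So the first
  integration by parts is done before differentiating again, and the second time derivative then
  falls on P. On the set where m vanishes, U, P and g have only right derivatives. Since m takes
  values in the nonnegative reals, the composites still have full derivatives in (x,t), and z P'(z)
  >= (1 - 1/d) P(z) reaches z = 0 by continuity. Db need not be symmetric, so tr((Db)^2) is not a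
  sum of squares of its entries. Writing A = V^T V, cyclicity of the trace replaces A D^2u by the
  symmetric matrix V D^2u V^T, which has the same trace and the same trace of the square;
  Cauchy-Schwarz on its diagonal gives the factor 1/d. The exponent 1 - 1/d is exactly what this
  gain pays for: it gives m P' - P >= -P/d, and the deficit is covered by P tr((Db)^2) >= P
  \<open>\<theta>\<close>^2/d.\<close>

lemma Ck_on_subset: "Ck_on k S f \<Longrightarrow> T \<subseteq> S \<Longrightarrow> Ck_on k T f"
proof (induction k arbitrary: f)
  case 0 then show ?case by (auto intro: continuous_on_subset)
next
  case (Suc k)
  then obtain f' where "\<forall>x\<in>S. (f has_derivative f' x) (at x within S)" "\<forall>b\<in>Basis. Ck_on k S (\<lambda>x. f' x b)"
    by auto
  with Suc.IH Suc.prems(2) show ?case unfolding Ck_on.simps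
    by (intro exI[of _ f']) (meson has_derivative_subset subsetD)
qed

lemma Ck_on_cong: "Ck_on k S f \<Longrightarrow> (\<And>x. x \<in> S \<Longrightarrow> g x = f x) \<Longrightarrow> Ck_on k S g"
proof (cases k)
  case 0 then show "Ck_on k S f \<Longrightarrow> (\<And>x. x \<in> S \<Longrightarrow> g x = f x) \<Longrightarrow> Ck_on k S g"
    by (auto cong: continuous_on_cong)
next
  case (Suc l) then show "Ck_on k S f \<Longrightarrow> (\<And>x. x \<in> S \<Longrightarrow> g x = f x) \<Longrightarrow> Ck_on k S g"
    by (auto intro: has_derivative_transform)
qed

text \<open>The recursive definition does not list lower orders. At the bottom, differentiability
  gives continuity; above it, the same derivative serves and the induction hypothesis lowers the
  order of its components.\<close>

lemma Ck_on_SucD: "Ck_on (Suc k) S f \<Longrightarrow> Ck_on k S f"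
proof (induction k arbitrary: f)
  case 0 then show ?case
    by (metis Ck_on.simps has_derivative_continuous continuous_on_eq_continuous_within)
next
  case (Suc k)
  then obtain f' where "\<forall>x\<in>S. (f has_derivative f' x) (at x within S)"
    "\<forall>b\<in>Basis. Ck_on (Suc k) S (\<lambda>x. f' x b)"
    by (subst (asm) Ck_on.simps(2)) blast
  then show ?case using Suc.IH unfolding Ck_on.simps(2)[of k] by blast
qed

lemma Ck_on_const: "Ck_on k S (\<lambda>x. c)"
proof (induction k arbitrary: c)
  case (Suc k)
  show ?case
    unfolding Ck_on.simps by (rule exI[of _ "\<lambda>x h. 0"]) (simp add: Suc)
qed simp

lemma Ck_on_add: "Ck_on k S f \<Longrightarrow> Ck_on k S g \<Longrightarrow> Ck_on k S (\<lambda>x. f x + g x)"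
proof (induction k arbitrary: f g)
  case 0 then show ?case by (auto intro: continuous_intros)
next
  case (Suc k)
  from Suc.prems obtain f' g' where
    "\<forall>x\<in>S. (f has_derivative f' x) (at x within S)" "\<forall>b\<in>Basis. Ck_on k S (\<lambda>x. f' x b)"
    "\<forall>x\<in>S. (g has_derivative g' x) (at x within S)" "\<forall>b\<in>Basis. Ck_on k S (\<lambda>x. g' x b)"
    by auto
  then show ?case unfolding Ck_on.simps
    by (intro exI[of _ "\<lambda>x h. f' x h + g' x h"]) (auto intro!: has_derivative_add Suc.IH)
qed

lemma Ck_on_mult:
  fixes f g :: "'a::euclidean_space \<Rightarrow> real"
  shows "Ck_on k S f \<Longrightarrow> Ck_on k S g \<Longrightarrow> Ck_on k S (\<lambda>x. f x * g x)"
proof (induction k arbitrary: f g)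
  case 0 then show ?case by (auto intro: continuous_intros)
next
  case (Suc k)
  from Suc.prems obtain f' g' where *:
    "\<forall>x\<in>S. (f has_derivative f' x) (at x within S)" "\<forall>b\<in>Basis. Ck_on k S (\<lambda>x. f' x b)"
    "\<forall>x\<in>S. (g has_derivative g' x) (at x within S)" "\<forall>b\<in>Basis. Ck_on k S (\<lambda>x. g' x b)"
    by auto
  \<comment> \<open>The product rule returns each factor undifferentiated, so the factors themselves
    are needed at the lower order.\<close>
  have "Ck_on k S f" "Ck_on k S g" using Suc.prems by (auto intro: Ck_on_SucD simp del: Ck_on.simps)
  with * show ?case unfolding Ck_on.simps
    by (intro exI[of _ "\<lambda>x h. f x * g' x h + f' x h * g x"])
      (auto intro!: has_derivative_mult Ck_on_add Suc.IH)
qed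

lemma Ck_on_sum: "(\<And>i. i \<in> I \<Longrightarrow> Ck_on k S (f i)) \<Longrightarrow> Ck_on k S (\<lambda>x. \<Sum>i\<in>I. f i x)"
  by (induction I rule: infinite_finite_induct) (auto intro: Ck_on_const Ck_on_add)

lemma has_derivative_vec:
  fixes f :: "'n::finite \<Rightarrow> 'a::real_normed_vector \<Rightarrow> real"
  assumes "\<And>i. (f i has_derivative f' i) F"
  shows "((\<lambda>x. \<chi> i. f i x) has_derivative (\<lambda>h. \<chi> i. f' i h)) F"
proof -
  have *: "(\<chi> i. g i) = (\<Sum>i\<in>UNIV. g i *\<^sub>R axis i 1)" for g :: "'n \<Rightarrow> real"
    using basis_expansion[of "\<chi> i. g i"] by (simp add: scalar_mult_eq_scaleR)
  show ?thesis unfolding *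
    by (intro has_derivative_sum has_derivative_scaleR_left assms)
qed

lemma linear_axis_expand:
  fixes L :: "real ^ 'n \<Rightarrow> 'b::real_vector"
  assumes "linear L"
  shows "L v = (\<Sum>i\<in>UNIV. v $ i *\<^sub>R L (axis i 1))"
proof -
  have "L v = L (\<Sum>i\<in>UNIV. v $ i *\<^sub>R axis i 1)"
    using basis_expansion[of v] by (simp add: scalar_mult_eq_scaleR)
  then show ?thesis using assms by (simp add: linear_sum linear_scale)
qed

text \<open>By the chain rule each derivative is a sum of products of derivatives of the
  \<open>w i\<close> with partial derivatives of \<open>H\<close>, composed with the same inner map.
  The induction therefore runs over all \<open>H\<close> with \<open>w\<close> fixed.\<close>

lemma Ck_on_compose_vec:
  fixes H :: "real ^ 'n \<Rightarrow> real" and w :: "'n \<Rightarrow> 'a::euclidean_space \<Rightarrow> real"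
  shows "Ck_on k UNIV H \<Longrightarrow> (\<And>i. Ck_on k S (w i)) \<Longrightarrow> Ck_on k S (\<lambda>x. H (\<chi> i. w i x))"
proof (induction k arbitrary: H)
  case 0
  have "continuous_on S (\<lambda>x. \<chi> i. w i x)" using 0 by (auto intro: continuous_on_vec_lambda)
  with 0 show ?case
    using continuous_on_compose2[of UNIV H] by auto
next
  case (Suc k)
  obtain H' where H': "\<And>p. (H has_derivative H' p) (at p)"
    "\<forall>b\<in>Basis. Ck_on k UNIV (\<lambda>p. H' p b)" using Suc.prems(1) by auto
  have "\<exists>w'. \<forall>i. (\<forall>x\<in>S. (w i has_derivative w' i x) (at x within S)) \<and> (\<forall>b\<in>Basis. Ck_on k S (\<lambda>x. w' i x b))"
    using Suc.prems(2) by (intro choice) auto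
  then obtain w' where w': "\<And>i x. x \<in> S \<Longrightarrow> (w i has_derivative w' i x) (at x within S)"
    "\<And>i b. b \<in> Basis \<Longrightarrow> Ck_on k S (\<lambda>x. w' i x b)" by blast
  have wk: "Ck_on k S (w i)" for i using Suc.prems(2) by (auto intro: Ck_on_SucD simp del: Ck_on.simps)
  have lin: "linear (H' p)" for p using H'(1) has_derivative_linear by blast
  show ?case unfolding Ck_on.simps
  proof (intro exI[of _ "\<lambda>x h. \<Sum>i\<in>UNIV. w' i x h * H' (\<chi> i. w i x) (axis i 1)"] conjI ballI)
    fix x assume "x \<in> S"
    then have "((\<lambda>x. \<chi> i. w i x) has_derivative (\<lambda>h. \<chi> i. w' i x h)) (at x within S)"
      by (intro has_derivative_vec w')
    from has_derivative_compose[OF this H'(1)]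
    show "((\<lambda>x. H (\<chi> i. w i x)) has_derivative (\<lambda>h. \<Sum>i\<in>UNIV. w' i x h * H' (\<chi> i. w i x) (axis i 1))) (at x within S)"
      by (subst (asm) linear_axis_expand[OF lin]) simp
  next
    fix b :: 'a assume "b \<in> Basis"
    then show "Ck_on k S (\<lambda>x. \<Sum>i\<in>UNIV. w' i x b * H' (\<chi> i. w i x) (axis i 1))"
      by (intro Ck_on_sum Ck_on_mult w' Suc.IH[of "\<lambda>p. H' p (axis i 1)" for i] wk)
        (use H'(2) in \<open>auto simp: Basis_vec_def\<close>)
  qed
qed

section \<open>Closure properties of smooth functions\<close>

lemma smooth_onI: "(\<And>k. Ck_on k S f) \<Longrightarrow> smooth_on S f"
  and smooth_onD: "smooth_on S f \<Longrightarrow> Ck_on k S f"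
  unfolding smooth_on_def by simp_all

lemma smooth_on_subset: "smooth_on S f \<Longrightarrow> T \<subseteq> S \<Longrightarrow> smooth_on T f"
  by (rule smooth_onI, rule Ck_on_subset, erule smooth_onD)

lemma smooth_on_continuous: "smooth_on S f \<Longrightarrow> continuous_on S f"
  using smooth_onD[of S f 0] by simp

lemma smooth_on_const: "smooth_on S (\<lambda>x. c)"
  by (rule smooth_onI, rule Ck_on_const)

lemma smooth_on_add: "smooth_on S f \<Longrightarrow> smooth_on S g \<Longrightarrow> smooth_on S (\<lambda>x. f x + g x)"
  by (rule smooth_onI, intro Ck_on_add smooth_onD)

lemma smooth_on_mult:
  fixes f g :: "'a::euclidean_space \<Rightarrow> real"
  shows "smooth_on S f \<Longrightarrow> smooth_on S g \<Longrightarrow> smooth_on S (\<lambda>x. f x * g x)"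
  by (rule smooth_onI, intro Ck_on_mult smooth_onD)

lemma smooth_on_diff:
  fixes f g :: "'a::euclidean_space \<Rightarrow> real"
  assumes "smooth_on S f" "smooth_on S g"
  shows "smooth_on S (\<lambda>x. f x - g x)"
  using smooth_on_add[OF assms(1) smooth_on_mult[OF smooth_on_const[of S "- 1"] assms(2)]] by simp

lemma smooth_on_sum: "(\<And>i. i \<in> I \<Longrightarrow> smooth_on S (f i)) \<Longrightarrow> smooth_on S (\<lambda>x. \<Sum>i\<in>I. f i x)"
  by (rule smooth_onI, intro Ck_on_sum smooth_onD)

lemma smooth_on_compose_vec:
  fixes H :: "real ^ 'n \<Rightarrow> real"
  shows "smooth_on UNIV H \<Longrightarrow> (\<And>i. smooth_on S (w i)) \<Longrightarrow> smooth_on S (\<lambda>x. H (\<chi> i. w i x))"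
  by (rule smooth_onI, intro Ck_on_compose_vec smooth_onD)

section \<open>Directional derivatives on open sets and symmetry of second derivatives\<close>

definition dirderiv :: "'a::real_normed_vector \<Rightarrow> ('a \<Rightarrow> 'b::real_normed_vector) \<Rightarrow> 'a \<Rightarrow> 'b" where
  "dirderiv v f z = frechet_derivative f (at z) v"

lemma dirderiv_eq: "(f has_derivative f') (at z) \<Longrightarrow> dirderiv v f z = f' v"
  unfolding dirderiv_def by (simp add: frechet_derivative_at[symmetric])

lemma dirderiv_cong:
  assumes "(g has_derivative g') (at z)" "open S" "z \<in> S" "\<And>y. y \<in> S \<Longrightarrow> f y = g y"
  shows "dirderiv v f z = g' v"
  by (rule dirderiv_eq, rule has_derivative_transform_within_open[OF assms(1-3)]) (simp add: assms(4))

lemma Ck_on_Suc_open: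
  assumes "Ck_on (Suc k) S f" "open S"
  obtains f' where "\<And>x. x \<in> S \<Longrightarrow> (f has_derivative f' x) (at x)"
    "\<And>b. b \<in> Basis \<Longrightarrow> Ck_on k S (\<lambda>x. f' x b)"
proof -
  obtain f' where *: "\<forall>x\<in>S. (f has_derivative f' x) (at x within S)"
    "\<forall>b\<in>Basis. Ck_on k S (\<lambda>x. f' x b)"
    using assms(1) unfolding Ck_on.simps by blast
  have "(f has_derivative f' x) (at x)" if "x \<in> S" for x
    using *(1) at_within_open[OF that assms(2)] that by metis
  with *(2) that show thesis by blast
qed

lemma smooth_on_has_derivative:
  assumes "smooth_on S f" "open S" "z \<in> S"
  shows "(f has_derivative (\<lambda>v. dirderiv v f z)) (at z)"
proof -
  have "Ck_on (Suc 0) S f" using assms(1) by (simp only: smooth_on_def)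
  then obtain f' where f': "\<And>x. x \<in> S \<Longrightarrow> (f has_derivative f' x) (at x)"
    "\<And>b. b \<in> Basis \<Longrightarrow> Ck_on 0 S (\<lambda>x. f' x b)"
    using assms(2) by (rule Ck_on_Suc_open) blast
  have "(\<lambda>v. dirderiv v f z) = f' z"
    by (intro ext dirderiv_eq f'(1) assms(3))
  then show ?thesis using f'(1)[OF assms(3)] by simp
qed

lemma smooth_on_dirderiv:
  assumes "smooth_on S f" "open S" "b \<in> Basis"
  shows "smooth_on S (dirderiv b f)"
  unfolding smooth_on_def
proof
  fix k
  have "Ck_on (Suc k) S f" using assms(1) by (simp only: smooth_on_def)
  then obtain f' where f': "\<And>x. x \<in> S \<Longrightarrow> (f has_derivative f' x) (at x)"
    "\<And>b. b \<in> Basis \<Longrightarrow> Ck_on k S (\<lambda>x. f' x b)"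
    using assms(2) by (rule Ck_on_Suc_open) blast
  show "Ck_on k S (dirderiv b f)"
    by (rule Ck_on_cong[OF f'(2)[OF assms(3)]]) (rule dirderiv_eq[OF f'(1)])
qed

lemma has_real_derivative_line:
  fixes f :: "'a::real_normed_vector \<Rightarrow> real"
  assumes "(f has_derivative f') (at (z + s *\<^sub>R v))"
  shows "((\<lambda>s. f (z + s *\<^sub>R v)) has_real_derivative f' v) (at s)"
proof -
  have "((\<lambda>s. z + s *\<^sub>R v) has_derivative (\<lambda>h. h *\<^sub>R v)) (at s)"
    by (auto intro!: derivative_eq_intros)
  from has_derivative_compose[OF this assms]
  have "((\<lambda>s. f (z + s *\<^sub>R v)) has_derivative (\<lambda>h. f' (h *\<^sub>R v))) (at s)" .
  moreover have "(\<lambda>h. f' (h *\<^sub>R v)) = (*) (f' v)"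
    using linear_scale[OF has_derivative_linear[OF assms]] by (auto simp: mult.commute)
  ultimately show ?thesis by (simp add: has_field_derivative_def)
qed

text \<open>The mean value theorem is used twice: in direction \<open>a\<close> for the increment of
  \<open>f\<close> across \<open>h *\<^sub>R b\<close>, which leaves a difference of
  \<open>dirderiv a f\<close> at one common \<open>s\<close>, and then in direction \<open>b\<close>
  for that difference.\<close>

lemma second_difference_mean_value:
  fixes f :: "'a::euclidean_space \<Rightarrow> real"
  assumes f: "smooth_on S f" and S: "open S" and ab: "a \<in> Basis" "b \<in> Basis" and h: "h > 0"
    and sub: "\<And>s t. s \<in> {0..h} \<Longrightarrow> t \<in> {0..h} \<Longrightarrow> z + s *\<^sub>R a + t *\<^sub>R b \<in> S"
  obtains s t where "s \<in> {0..h}" "t \<in> {0..h}"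
    "f (z + h *\<^sub>R a + h *\<^sub>R b) - f (z + h *\<^sub>R a) - f (z + h *\<^sub>R b) + f z
      = h\<^sup>2 * dirderiv b (dirderiv a f) (z + s *\<^sub>R a + t *\<^sub>R b)"
proof -
  define \<psi> where "\<psi> s = f ((z + h *\<^sub>R b) + s *\<^sub>R a) - f (z + s *\<^sub>R a)" for s
  have "(\<psi> has_real_derivative dirderiv a f ((z + h *\<^sub>R b) + s *\<^sub>R a) - dirderiv a f (z + s *\<^sub>R a)) (at s)"
    if "0 \<le> s" "s \<le> h" for s
    unfolding \<psi>_def
    by (intro DERIV_diff has_real_derivative_line smooth_on_has_derivative[OF f S])
      (use sub[of s h] sub[of s 0] that h in \<open>auto simp: algebra_simps\<close>)
  from MVT2[OF h this] obtain s where s: "0 < s" "s < h"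
    "\<psi> h - \<psi> 0 = h * (dirderiv a f ((z + h *\<^sub>R b) + s *\<^sub>R a) - dirderiv a f (z + s *\<^sub>R a))" by auto
  have "((\<lambda>t. dirderiv a f (z + s *\<^sub>R a + t *\<^sub>R b)) has_real_derivative
      dirderiv b (dirderiv a f) (z + s *\<^sub>R a + t *\<^sub>R b)) (at t)" if "0 \<le> t" "t \<le> h" for t
    by (intro has_real_derivative_line smooth_on_has_derivative[OF smooth_on_dirderiv[OF f S ab(1)] S])
      (use sub[of s t] that s in auto)
  from MVT2[OF h this] obtain t where t: "0 < t" "t < h"
    "dirderiv a f (z + s *\<^sub>R a + h *\<^sub>R b) - dirderiv a f (z + s *\<^sub>R a)
      = h * dirderiv b (dirderiv a f) (z + s *\<^sub>R a + t *\<^sub>R b)" by auto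
  have "\<psi> h - \<psi> 0 = h\<^sup>2 * dirderiv b (dirderiv a f) (z + s *\<^sub>R a + t *\<^sub>R b)"
    using s(3) t(3) by (simp add: power2_eq_square add.commute add.left_commute)
  moreover have "\<psi> h - \<psi> 0 = f (z + h *\<^sub>R a + h *\<^sub>R b) - f (z + h *\<^sub>R a) - f (z + h *\<^sub>R b) + f z"
    by (simp add: \<psi>_def algebra_simps)
  ultimately show thesis using that[of s t] s t by simp
qed

text \<open>Both mixed derivatives are limits of the same second difference quotient.\<close>

lemma dirderiv_commute:
  fixes f :: "'a::euclidean_space \<Rightarrow> real"
  assumes f: "smooth_on S f" and S: "open S" and z: "z \<in> S" and ab: "a \<in> Basis" "b \<in> Basis"
  shows "dirderiv a (dirderiv b f) z = dirderiv b (dirderiv a f) z"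
proof (rule ccontr)
  define u where "u = dirderiv a (dirderiv b f)"
  define v where "v = dirderiv b (dirderiv a f)"
  assume "dirderiv a (dirderiv b f) z \<noteq> dirderiv b (dirderiv a f) z"
  \<comment> \<open>Half the gap: a number within \<open>e\<close> of \<open>u z\<close> cannot also
    lie within \<open>e\<close> of \<open>v z\<close>.\<close>
  define e where "e = \<bar>u z - v z\<bar> / 2"
  have e: "e > 0" using \<open>_ \<noteq> _\<close> by (simp add: e_def u_def v_def)
  have cont: "continuous_on S u" "continuous_on S v"
    unfolding u_def v_def using f S ab by (auto intro!: smooth_on_continuous smooth_on_dirderiv)
  obtain r where r: "r > 0" "ball z r \<subseteq> S" using S z openE by blast
  obtain d1 where d1: "d1 > 0" "\<And>y. y \<in> S \<Longrightarrow> dist y z < d1 \<Longrightarrow> dist (u y) (u z) < e"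
    using cont(1) z e unfolding continuous_on_iff by blast
  obtain d2 where d2: "d2 > 0" "\<And>y. y \<in> S \<Longrightarrow> dist y z < d2 \<Longrightarrow> dist (v y) (v z) < e"
    using cont(2) z e unfolding continuous_on_iff by blast
  \<comment> \<open>Points of the square of side \<open>h\<close> are at distance at most
    \<open>2 * h\<close> from \<open>z\<close>, so a third of the smallest radius keeps them in all
    three balls.\<close>
  define h where "h = min r (min d1 d2) / 3"
  have h: "h > 0" "2 * h < r" "2 * h < d1" "2 * h < d2" using r d1 d2 by (auto simp: h_def)
  have dist: "dist (z + s *\<^sub>R x + t *\<^sub>R y) z \<le> 2 * h"
    if "s \<in> {0..h}" "t \<in> {0..h}" "x \<in> Basis" "y \<in> Basis" for s t x y
  proof -
    have "dist (z + s *\<^sub>R x + t *\<^sub>R y) z = norm (s *\<^sub>R x + t *\<^sub>R y)" by (simp add: dist_norm)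
    also have "\<dots> \<le> norm (s *\<^sub>R x) + norm (t *\<^sub>R y)" by (rule norm_triangle_ineq)
    also have "\<dots> \<le> 2 * h" using that by simp
    finally show ?thesis .
  qed
  have inS: "z + s *\<^sub>R x + t *\<^sub>R y \<in> S"
    if "s \<in> {0..h}" "t \<in> {0..h}" "x \<in> Basis" "y \<in> Basis" for s t x y
    using dist[OF that] h r(2) by (auto simp: subset_iff dist_commute)
  obtain s t where st: "s \<in> {0..h}" "t \<in> {0..h}"
    "f (z + h *\<^sub>R a + h *\<^sub>R b) - f (z + h *\<^sub>R a) - f (z + h *\<^sub>R b) + f z = h\<^sup>2 * v (z + s *\<^sub>R a + t *\<^sub>R b)"
    unfolding v_def using second_difference_mean_value[OF f S ab h(1), of z] inS ab by metis
  obtain s' t' where st': "s' \<in> {0..h}" "t' \<in> {0..h}"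
    "f (z + h *\<^sub>R b + h *\<^sub>R a) - f (z + h *\<^sub>R b) - f (z + h *\<^sub>R a) + f z = h\<^sup>2 * u (z + s' *\<^sub>R b + t' *\<^sub>R a)"
    unfolding u_def using second_difference_mean_value[OF f S ab(2,1) h(1), of z] inS ab by metis
  have "h\<^sup>2 * u (z + s' *\<^sub>R b + t' *\<^sub>R a) = h\<^sup>2 * v (z + s *\<^sub>R a + t *\<^sub>R b)"
    using st(3) st'(3) by (auto simp: algebra_simps)
  then have "u (z + s' *\<^sub>R b + t' *\<^sub>R a) = v (z + s *\<^sub>R a + t *\<^sub>R b)" using h by simp
  moreover have "dist (u (z + s' *\<^sub>R b + t' *\<^sub>R a)) (u z) < e"
    using dist[OF st'(1,2) ab(2,1)] inS[OF st'(1,2) ab(2,1)] h by (intro d1) auto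
  moreover have "dist (v (z + s *\<^sub>R a + t *\<^sub>R b)) (v z) < e"
    using dist[OF st(1,2) ab] inS[OF st(1,2) ab] h by (intro d2) auto
  ultimately show False unfolding e_def dist_real_def by (auto simp: abs_if split: if_splits)
qed

section \<open>Rules for directional derivatives\<close>

lemma dirderiv_diff:
  assumes "smooth_on S f" "smooth_on S g" "open S" "z \<in> S"
  shows "dirderiv v (\<lambda>z. f z - g z) z = dirderiv v f z - dirderiv v g z"
  by (rule dirderiv_eq[OF has_derivative_diff]; rule smooth_on_has_derivative; fact)

lemma dirderiv_mult:
  fixes f g :: "'a::euclidean_space \<Rightarrow> real"
  assumes "smooth_on S f" "smooth_on S g" "open S" "z \<in> S"
  shows "dirderiv v (\<lambda>z. f z * g z) z = f z * dirderiv v g z + dirderiv v f z * g z"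
  by (rule dirderiv_eq[OF has_derivative_mult]; rule smooth_on_has_derivative; fact)

lemma dirderiv_sum:
  assumes "\<And>i. i \<in> I \<Longrightarrow> smooth_on S (f i)" "open S" "z \<in> S"
  shows "dirderiv v (\<lambda>z. \<Sum>i\<in>I. f i z) z = (\<Sum>i\<in>I. dirderiv v (f i) z)"
  by (rule dirderiv_eq[OF has_derivative_sum]; rule smooth_on_has_derivative; use assms in simp)

lemma dirderiv_compose_vec:
  fixes H :: "real ^ 'n \<Rightarrow> real"
  assumes "smooth_on UNIV H" "\<And>i. smooth_on S (w i)" "open S" "z \<in> S"
  shows "dirderiv v (\<lambda>z. H (\<chi> i. w i z)) z
    = (\<Sum>i\<in>UNIV. dirderiv (axis i 1) H (\<chi> i. w i z) * dirderiv v (w i) z)"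
proof -
  have H: "(H has_derivative (\<lambda>v. dirderiv v H p)) (at p)" for p
    by (rule smooth_on_has_derivative[OF assms(1)]) auto
  have "((\<lambda>z. \<chi> i. w i z) has_derivative (\<lambda>v. \<chi> i. dirderiv v (w i) z)) (at z)"
    by (intro has_derivative_vec smooth_on_has_derivative[OF assms(2-4)])
  from dirderiv_eq[OF has_derivative_compose[OF this H], of v] show ?thesis
    by (subst (asm) linear_axis_expand[OF has_derivative_linear[OF H]]) (simp add: mult.commute)
qed

lemma dirderiv_periodic:
  assumes f: "smooth_on S f" and S: "open S" and z: "z \<in> S"
    and inv: "\<And>y. y \<in> S \<Longrightarrow> y + e \<in> S" and per: "\<And>y. y \<in> S \<Longrightarrow> f (y + e) = f y"
  shows "dirderiv v f (z + e) = dirderiv v f z"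
proof -
  have shift: "((\<lambda>y. y + e) has_derivative (\<lambda>v. v)) (at z)" by (auto intro!: derivative_eq_intros)
  have "((\<lambda>y. f (y + e)) has_derivative (\<lambda>v. dirderiv v f (z + e))) (at z)"
    by (rule has_derivative_compose[OF shift smooth_on_has_derivative[OF f S inv[OF z]]])
  from dirderiv_cong[OF this S z] per show ?thesis by metis
qed

section \<open>Trace inequality\<close>

lemma sum_of_bool_mult:
  fixes f :: "'n::finite \<Rightarrow> real"
  shows "(\<Sum>i\<in>UNIV. of_bool (i = p) * f i) = f p"
  by (subst sum.mono_neutral_right[of _ "{p}"]) auto

text \<open>Cholesky decomposition: each step subtracts a rank-one matrix that clears row \<open>p\<close>.\<close>

lemma psd_sum_rank_one:
  fixes a :: "'n::finite \<Rightarrow> 'n \<Rightarrow> real"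
  assumes "\<And>i j. a i j = a j i" "\<And>x. (\<Sum>i\<in>UNIV. \<Sum>j\<in>UNIV. x i * x j * a i j) \<ge> 0"
    and "\<And>i j. i \<notin> I \<or> j \<notin> I \<Longrightarrow> a i j = 0"
  shows "\<exists>v. \<forall>i j. a i j = (\<Sum>k\<in>I. v k i * v k j)"
proof -
  have "finite I" by simp
  then show ?thesis using assms
  proof (induction I arbitrary: a rule: finite_induct)
    case empty then show ?case by simp
  next
    case (insert p I)
    note sym = insert.prems(1) and psd = insert.prems(2) and supp = insert.prems(3)
    define r where "r x = (\<Sum>j\<in>UNIV. x j * a p j)" for x
    \<comment> \<open>The quadratic form at \<open>x\<close> moved by \<open>y\<close> along the
      unit vector of index \<open>p\<close>, as a polynomial in \<open>y\<close>. Both the zero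
      pivot and the Schur complement are read off from its nonnegativity.\<close>
    have exp: "(\<Sum>i\<in>UNIV. \<Sum>j\<in>UNIV. (x i + y * of_bool (i = p)) * (x j + y * of_bool (j = p)) * a i j)
      = (\<Sum>i\<in>UNIV. \<Sum>j\<in>UNIV. x i * x j * a i j) + 2 * y * r x + y\<^sup>2 * a p p" for x y
    proof -
      have "(\<Sum>i\<in>UNIV. \<Sum>j\<in>UNIV. (x i + y * of_bool (i = p)) * (x j + y * of_bool (j = p)) * a i j)
        = (\<Sum>i\<in>UNIV. \<Sum>j\<in>UNIV. x i * x j * a i j) + (\<Sum>i\<in>UNIV. \<Sum>j\<in>UNIV. of_bool (j = p) * (y * x i * a i j))
          + (\<Sum>i\<in>UNIV. of_bool (i = p) * (\<Sum>j\<in>UNIV. y * x j * a i j))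
          + (\<Sum>i\<in>UNIV. of_bool (i = p) * (\<Sum>j\<in>UNIV. of_bool (j = p) * (y\<^sup>2 * a i j)))"
        unfolding sum_distrib_left sum.distrib[symmetric]
        by (intro sum.cong refl) (simp add: algebra_simps power2_eq_square)
      also have "\<dots> = (\<Sum>i\<in>UNIV. \<Sum>j\<in>UNIV. x i * x j * a i j) + (\<Sum>i\<in>UNIV. y * x i * a i p)
          + (\<Sum>j\<in>UNIV. y * x j * a p j) + y\<^sup>2 * a p p"
        by (simp only: sum_of_bool_mult)
      also have "(\<Sum>i\<in>UNIV. y * x i * a i p) = y * r x"
        unfolding r_def sum_distrib_left by (intro sum.cong refl) (simp add: sym[of _ p])
      also have "(\<Sum>j\<in>UNIV. y * x j * a p j) = y * r x"
        unfolding r_def sum_distrib_left by (intro sum.cong refl) simp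
      finally show ?thesis by simp
    qed
    have quad: "(\<Sum>i\<in>UNIV. \<Sum>j\<in>UNIV. x i * x j * a i j) + 2 * y * r x + y\<^sup>2 * a p p \<ge> 0" for x y
      using psd[of "\<lambda>i. x i + y * of_bool (i = p)"] exp[of x y] by simp
    have app: "a p p \<ge> 0" using quad[of "\<lambda>_. 0" 1] by (simp add: r_def)
    show ?case
    proof (cases "a p p = 0")
      case True
      \<comment> \<open>With a zero pivot the polynomial is affine in \<open>y\<close>; being
        bounded below, it has slope zero. Hence row and column \<open>p\<close> vanish and the
        support shrinks to \<open>I\<close>.\<close>
      have ap0: "a p q = 0" for q
      proof (rule ccontr)
        assume ne: "a p q \<noteq> 0"
        define c where "c = a q q"
        have "(\<Sum>i\<in>UNIV. \<Sum>j\<in>UNIV. of_bool (i = q) * of_bool (j = q) * a i j) = c"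
          unfolding mult.assoc sum_distrib_left[symmetric] by (simp only: sum_of_bool_mult c_def)
        moreover have "r (\<lambda>j. of_bool (j = q)) = a p q"
          by (simp only: sum_of_bool_mult r_def)
        ultimately have "c + 2 * y * a p q \<ge> 0" for y
          using quad[of "\<lambda>j. of_bool (j = q)" y] True by simp
        \<comment> \<open>This \<open>y\<close> makes the affine expression equal to -1.\<close>
        from this[of "- (c + 1) / (2 * a p q)"] ne show False by (simp add: field_simps)
      qed
      have "a i j = 0" if "i \<notin> I \<or> j \<notin> I" for i j
        using that ap0 sym supp by (metis insert_iff)
      from insert.IH[OF sym psd this] obtain v where v: "\<And>i j. a i j = (\<Sum>k\<in>I. v k i * v k j)" by blast
      have "a i j = (\<Sum>k\<in>insert p I. (v(p := \<lambda>_. 0)) k i * (v(p := \<lambda>_. 0)) k j)" for i j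
        using insert.hyps by (auto simp: v intro!: sum.cong)
      then show ?thesis by blast
    next
      case False
      with app have pos: "a p p > 0" by simp
      define b where "b i j = a i j - a p i * a p j / a p p" for i j
      have "b i j = b j i" for i j by (simp add: b_def sym[of i j])
      moreover have "(\<Sum>i\<in>UNIV. \<Sum>j\<in>UNIV. x i * x j * b i j) \<ge> 0" for x
      proof -
        have "(\<Sum>i\<in>UNIV. \<Sum>j\<in>UNIV. x i * x j * b i j)
          = (\<Sum>i\<in>UNIV. \<Sum>j\<in>UNIV. x i * x j * a i j) - (r x)\<^sup>2 / a p p"
          unfolding b_def r_def power2_eq_square sum_product sum_divide_distrib sum_subtractf[symmetric]
          by (intro sum.cong refl) (simp add: algebra_simps)
        \<comment> \<open>The form of the Schur complement \<open>b\<close> is the minimum over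
          \<open>y\<close> of the shifted form, attained at
          \<open>y = - r x / a p p\<close>.\<close>
        also have "\<dots> = (\<Sum>i\<in>UNIV. \<Sum>j\<in>UNIV. x i * x j * a i j) + 2 * (- r x / a p p) * r x + (- r x / a p p)\<^sup>2 * a p p"
          using pos by (simp add: field_simps power2_eq_square)
        also have "\<dots> \<ge> 0" by (rule quad)
        finally show ?thesis .
      qed
      moreover have "b i j = 0" if "i \<notin> I \<or> j \<notin> I" for i j
        using that pos supp[of p] supp[of i j] sym by (cases "i = p"; cases "j = p") (auto simp: b_def)
      ultimately obtain v where v: "\<And>i j. b i j = (\<Sum>k\<in>I. v k i * v k j)"
        using insert.IH[of b] by blast
      define w where "w = v(p := \<lambda>i. a p i / sqrt (a p p))"
      have "a i j = (\<Sum>k\<in>insert p I. w k i * w k j)" for i j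
      proof -
        have "(\<Sum>k\<in>I. w k i * w k j) = b i j"
          unfolding v using insert.hyps by (intro sum.cong) (auto simp: w_def)
        moreover have "w p i * w p j = a p i * a p j / a p p"
          using pos by (simp add: w_def)
        ultimately show ?thesis using insert.hyps by (simp add: b_def)
      qed
      then show ?thesis by blast
    qed
  qed
qed

text \<open>Write a = V^T V with rows \<open>v k\<close>. Then c = V^T (V s), and cyclicity of the
  trace moves V^T to the right: c and e = V s V^T have equal traces, and so do their squares. As e
  is symmetric, tr(e^2) is the sum of the squares of all its entries, hence at least that of the
  diagonal ones, to which Cauchy-Schwarz applies.\<close>

lemma trace_square_psd_sym:
  fixes a s :: "'n::finite \<Rightarrow> 'n \<Rightarrow> real"
  assumes "\<And>i j. a i j = a j i" "\<And>x. (\<Sum>i\<in>UNIV. \<Sum>j\<in>UNIV. x i * x j * a i j) \<ge> 0"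
    and "\<And>i j. s i j = s j i"
  defines "c \<equiv> \<lambda>i j. \<Sum>k\<in>UNIV. a i k * s k j"
  shows "(\<Sum>i\<in>UNIV. c i i)\<^sup>2 / real CARD('n) \<le> (\<Sum>i\<in>UNIV. \<Sum>j\<in>UNIV. c i j * c j i)"
proof -
  have "\<exists>v :: 'n \<Rightarrow> 'n \<Rightarrow> real. \<forall>i j. a i j = (\<Sum>k\<in>UNIV. v k i * v k j)"
    by (rule psd_sum_rank_one[of a UNIV, OF assms(1,2)]) auto
  then obtain v :: "'n \<Rightarrow> 'n \<Rightarrow> real" where v: "\<And>i j. a i j = (\<Sum>k\<in>UNIV. v k i * v k j)"
    by blast
  define e where "e k l = (\<Sum>i\<in>UNIV. \<Sum>j\<in>UNIV. v k i * s i j * v l j)" for k l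
  have c: "c i j = (\<Sum>k\<in>UNIV. v k i * (\<Sum>l\<in>UNIV. v k l * s l j))" for i j
  proof -
    have "c i j = (\<Sum>l\<in>UNIV. \<Sum>k\<in>UNIV. v k i * (v k l * s l j))"
      unfolding c_def v sum_distrib_right by (simp add: mult.assoc)
    then show ?thesis by (subst (asm) sum.swap) (simp add: sum_distrib_left)
  qed
  have e': "e k m = (\<Sum>j\<in>UNIV. (\<Sum>l\<in>UNIV. v k l * s l j) * v m j)" for k m
    unfolding e_def sum_distrib_right by (rule sum.swap)
  have esym: "e k l = e l k" for k l
    unfolding e_def by (subst sum.swap) (intro sum.cong refl, simp add: assms(3) mult.commute mult.left_commute)
  have tr: "(\<Sum>i\<in>UNIV. c i i) = (\<Sum>k\<in>UNIV. e k k)"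
    unfolding c e' by (subst sum.swap) (simp add: mult.commute)
  have "(\<Sum>i\<in>UNIV. \<Sum>j\<in>UNIV. c i j * c j i) = (\<Sum>k\<in>UNIV. \<Sum>m\<in>UNIV. e k m * e m k)"
  proof -
    \<comment> \<open>f = V s, so that c = V^T f and e = f V^T. The chain below only reorders the
      sums in tr(V^T f V^T f).\<close>
    define f where "f k j = (\<Sum>l\<in>UNIV. v k l * s l j)" for k j
    have "(\<Sum>i\<in>UNIV. \<Sum>j\<in>UNIV. c i j * c j i)
        = (\<Sum>i\<in>UNIV. \<Sum>j\<in>UNIV. \<Sum>k\<in>UNIV. \<Sum>m\<in>UNIV. (v k i * f k j) * (v m j * f m i))"
      unfolding c f_def[symmetric] sum_product ..
    also have "\<dots> = (\<Sum>i\<in>UNIV. \<Sum>k\<in>UNIV. \<Sum>m\<in>UNIV. \<Sum>j\<in>UNIV. (v k i * f k j) * (v m j * f m i))"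
      by (subst (2) sum.swap, subst (3) sum.swap) rule
    also have "\<dots> = (\<Sum>k\<in>UNIV. \<Sum>m\<in>UNIV. \<Sum>i\<in>UNIV. \<Sum>j\<in>UNIV. (v k i * f k j) * (v m j * f m i))"
      by (subst sum.swap, subst (2) sum.swap) rule
    also have "\<dots> = (\<Sum>k\<in>UNIV. \<Sum>m\<in>UNIV. (\<Sum>j\<in>UNIV. f k j * v m j) * (\<Sum>i\<in>UNIV. f m i * v k i))"
      unfolding sum_product
      by (rule sum.cong[OF refl], rule sum.cong[OF refl], subst sum.swap, intro sum.cong refl) (simp add: mult_ac)
    finally show ?thesis by (simp add: e' f_def)
  qed
  moreover have "(\<Sum>k\<in>UNIV. (e k k)\<^sup>2) \<le> (\<Sum>k\<in>UNIV. \<Sum>m\<in>UNIV. e k m * e m k)"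
  proof (rule sum_mono)
    fix k
    have "(e k k)\<^sup>2 = e k k * e k k" by (simp add: power2_eq_square)
    also have "\<dots> \<le> (\<Sum>m\<in>UNIV. e k m * e m k)"
      by (rule member_le_sum) (auto simp: esym[of _ k])
    finally show "(e k k)\<^sup>2 \<le> (\<Sum>m\<in>UNIV. e k m * e m k)" .
  qed
  moreover have "(\<Sum>k\<in>UNIV. e k k)\<^sup>2 \<le> (\<Sum>k\<in>UNIV. (e k k)\<^sup>2) * real CARD('n)"
    by (rule sum_squared_le_sum_of_squares)
  ultimately show ?thesis unfolding tr
    by (simp add: divide_le_eq) (meson mult_right_mono of_nat_0_le_iff order_trans)
qed

section \<open>Monotonicity and convexity\<close>

text \<open>The derivative is a limit of nonnegative difference quotients. Taking it within
  \<open>A\<close> covers the right derivative of \<open>g\<close> at 0, and \<open>A = UNIV\<close>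
  covers the slope of a convex function.\<close>

lemma mono_on_within_deriv_nonneg:
  fixes f :: "real \<Rightarrow> real"
  assumes "mono_on A f" "(f has_real_derivative D) (at x within A)" "x \<in> A" "at x within A \<noteq> bot"
  shows "D \<ge> 0"
proof (rule tendsto_lowerbound)
  show "((\<lambda>y. (f y - f x) / (y - x)) \<longlongrightarrow> D) (at x within A)"
    using assms(2) by (simp add: has_field_derivative_iff)
  have "(f y - f x) / (y - x) \<ge> 0" if "y \<in> A" for y
    using assms(1,3) that by (cases "x \<le> y") (auto simp: mono_on_def divide_nonpos_nonpos)
  then show "\<forall>\<^sub>F y in at x within A. 0 \<le> (f y - f x) / (y - x)"
    by (auto simp: eventually_at_filter)
qed (use assms in auto)

text \<open>The graph lies above its tangents at \<open>x\<close> and at \<open>y\<close>; adding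
  these two inequalities leaves the comparison of the slopes.\<close>

lemma convex_deriv_mono:
  fixes \<phi> :: "real \<Rightarrow> real"
  assumes "convex_on UNIV \<phi>" "\<And>s. (\<phi> has_real_derivative \<phi>' s) (at s)"
  shows "mono \<phi>'"
proof (rule monoI)
  fix x y :: real assume "x \<le> y"
  have "\<phi> t - \<phi> s \<ge> \<phi>' s * (t - s)" for s t
    using convex_on_imp_above_tangent[OF assms(1), of s t "\<phi>' s"] assms(2)[of s] by auto
  from this[of x y] this[of y x] have "\<phi>' x * (y - x) \<le> \<phi>' y * (y - x)"
    by (simp add: algebra_simps)
  with \<open>x \<le> y\<close> show "\<phi>' x \<le> \<phi>' y" by (cases "x = y") auto
qed

text \<open>The quadratic form in \<open>x\<close> is the second derivative at 0 of \<open>H\<close>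
  restricted to the line through \<open>p\<close> in direction \<open>x\<close>. That restriction is
  convex, so its first derivative is monotone.\<close>

lemma convex_hessian_psd:
  fixes H :: "real ^ 'n \<Rightarrow> real"
  assumes H: "smooth_on UNIV H" and cvx: "convex_on UNIV H"
  shows "(\<Sum>i\<in>UNIV. \<Sum>j\<in>UNIV. x i * x j * dirderiv (axis j 1) (dirderiv (axis i 1) H) p) \<ge> 0"
proof -
  define v where "v = (\<chi> i. x i)"
  have axB: "axis i 1 \<in> (Basis :: (real ^ 'n) set)" for i by (auto simp: Basis_vec_def)
  have expand: "dirderiv v f q = (\<Sum>i\<in>UNIV. x i * dirderiv (axis i 1) f q)" if "smooth_on UNIV f" for f :: "real ^ 'n \<Rightarrow> real" and q
    using linear_axis_expand[OF has_derivative_linear[OF smooth_on_has_derivative[OF that, of q]], of v]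
    by (simp add: v_def)
  have dH: "smooth_on UNIV (dirderiv (axis i 1) H)" for i
    by (rule smooth_on_dirderiv[OF H _ axB]) simp
  define \<phi> where "\<phi> s = H (p + s *\<^sub>R v)" for s
  define \<phi>' where "\<phi>' s = (\<Sum>i\<in>UNIV. x i * dirderiv (axis i 1) H (p + s *\<^sub>R v))" for s
  have 1: "(\<phi> has_real_derivative \<phi>' s) (at s)" for s
    unfolding \<phi>_def \<phi>'_def expand[OF H, symmetric]
    by (intro has_real_derivative_line smooth_on_has_derivative[OF H]) auto
  have d2: "(\<phi>' has_real_derivative (\<Sum>i\<in>UNIV. x i * dirderiv v (dirderiv (axis i 1) H) (p + s *\<^sub>R v))) (at s)" for s
    unfolding \<phi>'_def
    by (intro DERIV_sum DERIV_cmult has_real_derivative_line smooth_on_has_derivative[OF dH]) auto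
  have "convex_on UNIV \<phi>"
  proof (rule convex_onI)
    fix t y z :: real assume "0 < t" "t < 1"
    then show "\<phi> ((1 - t) *\<^sub>R y + t *\<^sub>R z) \<le> (1 - t) * \<phi> y + t * \<phi> z"
      using convex_onD[OF cvx, of t "p + y *\<^sub>R v" "p + z *\<^sub>R v"] by (simp add: \<phi>_def algebra_simps)
  qed auto
  then have mono: "mono \<phi>'" by (rule convex_deriv_mono) (rule 1)
  have "(\<Sum>i\<in>UNIV. x i * dirderiv v (dirderiv (axis i 1) H) (p + 0 *\<^sub>R v)) \<ge> 0"
    by (rule mono_on_within_deriv_nonneg[of UNIV \<phi>' _ 0, OF mono d2]) simp_all
  then show ?thesis
    by (simp add: expand[OF dH] sum_distrib_left mult.assoc)
qed

text \<open>For \<open>z > 0\<close> the derivative of the quotient has the sign of z P' -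
  \<open>\<alpha>\<close> P, and \<open>\<alpha>\<close> P >= 0 then forces P' >= 0. At
  \<open>z = 0\<close>, where the quotient gives no information, both inequalities follow from
  continuity, 0 being in the closure of the positive reals.\<close>

lemma power_growth_derivative:
  fixes P P' :: "real \<Rightarrow> real"
  assumes der: "\<And>z. z \<ge> 0 \<Longrightarrow> (P has_real_derivative P' z) (at z within {0..})"
    and cont: "continuous_on {0..} P'" and nonneg: "\<And>z. z \<ge> 0 \<Longrightarrow> P z \<ge> 0"
    and mono: "mono_on {0<..} (\<lambda>z. P z / z powr \<alpha>)" and \<alpha>: "\<alpha> \<ge> 0" and z: "z \<ge> 0"
  shows "\<alpha> * P z \<le> z * P' z" "P' z \<ge> 0"
proof -
  have pos: "\<alpha> * P z \<le> z * P' z \<and> P' z \<ge> 0" if z: "z > 0" for z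
  proof -
    have "(P has_real_derivative P' z) (at z)"
      using der[of z] z at_within_interior[of z "{0..}"] by simp
    then have "((\<lambda>z. P z / z powr \<alpha>) has_real_derivative
        (P' z * z powr \<alpha> - P z * (\<alpha> * z powr (\<alpha> - 1))) / (z powr \<alpha> * z powr \<alpha>)) (at z)"
      using z by (auto intro!: derivative_eq_intros)
    from mono_on_imp_deriv_nonneg[OF mono this] z
    have "(P' z * z powr \<alpha> - P z * (\<alpha> * z powr (\<alpha> - 1))) / (z powr \<alpha> * z powr \<alpha>) \<ge> 0"
      by (simp add: interior_open)
    moreover have "z powr \<alpha> * z powr \<alpha> > 0" using z by simp
    ultimately have "P' z * z powr \<alpha> - P z * (\<alpha> * z powr (\<alpha> - 1)) \<ge> 0"
      unfolding zero_le_divide_iff by linarith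
    moreover have "z powr \<alpha> = z * z powr (\<alpha> - 1)" using z by (simp add: powr_mult_base)
    ultimately have "z powr (\<alpha> - 1) * (z * P' z - \<alpha> * P z) \<ge> 0" by (simp add: algebra_simps)
    then have 1: "\<alpha> * P z \<le> z * P' z" using z by (simp add: zero_le_mult_iff)
    have "0 \<le> \<alpha> * P z" using \<alpha> nonneg[of z] z by simp
    with 1 have "0 \<le> z * P' z" by linarith
    with z 1 show ?thesis by (simp add: zero_le_mult_iff)
  qed
  have cP: "continuous_on {0..} P"
    using der by (auto simp: continuous_on_eq_continuous_within intro: DERIV_continuous)
  have "z * P' z - \<alpha> * P z \<ge> 0"
    by (rule continuous_ge_on_closure[of "{0<..}" "\<lambda>z. z * P' z - \<alpha> * P z" z 0])
      (use z pos cont cP in \<open>auto intro!: continuous_intros\<close>)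
  moreover have "P' z \<ge> 0"
    by (rule continuous_ge_on_closure[of "{0<..}" P' z 0]) (use z pos cont in auto)
  ultimately show "\<alpha> * P z \<le> z * P' z" "P' z \<ge> 0" by auto
qed

text \<open>The equations hold at interior times only; this carries the convexity obtained there to
  the end points.\<close>

lemma convex_on_closed_interval:
  fixes F :: "real \<Rightarrow> real"
  assumes "convex_on {0<..<T} F" "continuous_on {0..T} F" "T > 0"
  shows "convex_on {0..T} F"
proof (rule convex_onI)
  fix t x y :: real assume t: "0 < t" "t < 1" and xy: "x \<in> {0..T}" "y \<in> {0..T}"
  \<comment> \<open>Contraction towards the midpoint T/2. It is affine in \<open>v\<close>, so it
    respects convex combinations, and for \<open>\<epsilon>\<close> strictly between 0 and 1 it maps
    the closed interval into the open one. The convexity inequality passes to the limit as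
    \<open>\<epsilon>\<close> tends to 0.\<close>
  define A where "A \<epsilon> v = (1 - \<epsilon>) * v + \<epsilon> * (T / 2)" for \<epsilon> v :: real
  define z where "z = (1 - t) *\<^sub>R x + t *\<^sub>R y"
  have z: "z \<in> {0..T}" unfolding z_def by (rule convexD_alt[OF _ xy]) (use t in auto)
  have A: "A \<epsilon> v \<in> {0..T}" if "\<epsilon> \<in> {0..1}" "v \<in> {0..T}" for \<epsilon> v
    using convexD_alt[of "{0..T}" v "T / 2" \<epsilon>] that assms(3) by (simp add: A_def)
  have A': "A \<epsilon> v \<in> {0<..<T}" if \<epsilon>: "\<epsilon> \<in> {0<..<1}" and v: "v \<in> {0..T}" for \<epsilon> v
  proof -
    have "\<epsilon> * (T / 2) > 0" "\<epsilon> * (T / 2) < \<epsilon> * T" using \<epsilon> assms(3) by simp_all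
    moreover have "(1 - \<epsilon>) * v \<ge> 0" "(1 - \<epsilon>) * v \<le> (1 - \<epsilon>) * T" using \<epsilon> v by (auto intro!: mult_left_mono)
    ultimately show ?thesis by (simp add: A_def algebra_simps)
  qed
  have cont: "continuous_on {0..1} (\<lambda>\<epsilon>. F (A \<epsilon> v))" if "v \<in> {0..T}" for v
    by (rule continuous_on_compose2[OF assms(2)]) (use A[OF _ that] in \<open>auto simp: A_def intro!: continuous_intros\<close>)
  have "(1 - t) * F (A 0 x) + t * F (A 0 y) - F (A 0 z) \<ge> 0"
  proof (rule continuous_ge_on_closure[where S = "{0<..<1::real}" and x = 0
        and f = "\<lambda>\<epsilon>. (1 - t) * F (A \<epsilon> x) + t * F (A \<epsilon> y) - F (A \<epsilon> z)"])
    show "continuous_on (closure {0<..<1}) (\<lambda>\<epsilon>. (1 - t) * F (A \<epsilon> x) + t * F (A \<epsilon> y) - F (A \<epsilon> z))"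
      using xy z by (auto intro!: continuous_intros cont)
    fix \<epsilon> :: real assume \<epsilon>: "\<epsilon> \<in> {0<..<1}"
    have "A \<epsilon> z = (1 - t) *\<^sub>R A \<epsilon> x + t *\<^sub>R A \<epsilon> y" by (simp add: A_def z_def field_simps)
    then show "(1 - t) * F (A \<epsilon> x) + t * F (A \<epsilon> y) - F (A \<epsilon> z) \<ge> 0"
      using convex_onD[OF assms(1), of t "A \<epsilon> x" "A \<epsilon> y"] t A'[OF \<epsilon>] xy by simp
  qed simp
  then show "F ((1 - t) *\<^sub>R x + t *\<^sub>R y) \<le> (1 - t) * F x + t * F y"
    by (simp add: A_def z_def)
qed simp

lemma at_within_atLeast_ne_bot:
  fixes r :: real
  assumes "r \<ge> a"
  shows "at r within {a..} \<noteq> bot"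
proof -
  have "at_right r \<le> at r within {a..}" using assms by (intro at_le) auto
  then show ?thesis using trivial_limit_at_right_real[of r] by (auto simp: bot_unique)
qed

lemma Ck_on_1_real_derivative:
  fixes f :: "real \<Rightarrow> real"
  assumes "Ck_on 1 S f"
  obtains f' where "\<And>r. r \<in> S \<Longrightarrow> (f has_real_derivative f' r) (at r within S)" "continuous_on S f'"
proof -
  obtain D where D: "\<forall>r\<in>S. (f has_derivative D r) (at r within S)" "continuous_on S (\<lambda>r. D r 1)"
    using assms by auto
  have "(f has_real_derivative D r 1) (at r within S)" if "r \<in> S" for r
  proof -
    have d: "(f has_derivative D r) (at r within S)" using D(1) that by blast
    have "D r h = D r 1 * h" for h
      using linear_scale[OF has_derivative_linear[OF d], of h 1] by (simp add: mult.commute)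
    then show ?thesis
      unfolding has_field_derivative_def by (intro has_derivative_eq_rhs[OF d] ext)
  qed
  from this D(2) show thesis by (rule that)
qed

section \<open>Integration over the torus\<close>

text \<open>Stretch the cell to length 1 + \<open>s\<close> along axis \<open>i\<close> and cut the
  long box in two ways, at height \<open>s\<close> and at height 1. One way leaves the shifted cell,
  the other the original cell; the leftover pieces of thickness \<open>s\<close> are translates of
  each other by one period.\<close>

lemma integral_slab_shift:
  fixes F :: "real ^ 'n \<Rightarrow> real"
  assumes cont: "continuous_on UNIV F" and per: "\<And>x. F (x + axis i 1) = F x" and s: "s \<in> {0..1}"
  shows "integral (cbox 0 1) (\<lambda>x. F (x + s *\<^sub>R axis i 1)) = integral (cbox 0 1) F"
proof -
  define e where "e = (axis i 1 :: real ^ 'n)"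
  have eB: "e \<in> Basis" by (auto simp: e_def Basis_vec_def)
  have e_nth: "e $ j = (if j = i then 1 else 0)" for j by (simp add: e_def axis_def)
  have dot: "x \<bullet> e = x $ i" for x by (simp add: e_def inner_axis)
  have mem: "x \<in> cbox a b \<longleftrightarrow> (a $ i \<le> x $ i \<and> x $ i \<le> b $ i) \<and> (\<forall>j. j \<noteq> i \<longrightarrow> a $ j \<le> x $ j \<and> x $ j \<le> b $ j)"
    for a b x :: "real ^ 'n"
    unfolding mem_box_cart
  proof (intro iffI allI)
    show "a $ j \<le> x $ j \<and> x $ j \<le> b $ j"
      if "(a $ i \<le> x $ i \<and> x $ i \<le> b $ i) \<and> (\<forall>j. j \<noteq> i \<longrightarrow> a $ j \<le> x $ j \<and> x $ j \<le> b $ j)" for j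
      using that by (cases "j = i") auto
  qed auto
  let ?A = "cbox 0 (1 + s *\<^sub>R e)"
  have int: "F integrable_on ?A" by (intro integrable_continuous continuous_on_subset[OF cont]) auto
  \<comment> \<open>The corner \<open>s *\<^sub>R e + (1 - e)\<close> has coordinate
    \<open>s\<close> along axis \<open>i\<close> and 1 along all others.\<close>
  have "?A \<inter> {x. x \<bullet> e \<ge> s} = cbox (0 + s *\<^sub>R e) (1 + s *\<^sub>R e)"
    "?A \<inter> {x. x \<bullet> e \<le> 1} = cbox 0 1"
    "?A \<inter> {x. x \<bullet> e \<ge> 1} = cbox (0 + e) (s *\<^sub>R e + (1 - e) + e)"
    "?A \<inter> {x. x \<bullet> e \<le> s} = cbox 0 (s *\<^sub>R e + (1 - e))"
    by (rule set_eqI, use s in \<open>auto simp: mem dot e_nth\<close>)+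
  moreover have "integral ?A F = integral (?A \<inter> {x. x \<bullet> e \<le> s}) F + integral (?A \<inter> {x. x \<bullet> e \<ge> s}) F"
    "integral ?A F = integral (?A \<inter> {x. x \<bullet> e \<le> 1}) F + integral (?A \<inter> {x. x \<bullet> e \<ge> 1}) F"
    by (intro integral_split int eB)+
  moreover have "integral (cbox (0 + e) (s *\<^sub>R e + (1 - e) + e)) F = integral (cbox 0 (s *\<^sub>R e + (1 - e))) F"
    unfolding integral_shift_cbox_plus[symmetric] using per by (simp add: o_def e_def add.commute)
  moreover have "integral (cbox (0 + s *\<^sub>R e) (1 + s *\<^sub>R e)) F = integral (cbox 0 1) (\<lambda>x. F (x + s *\<^sub>R e))"
    unfolding integral_shift_cbox_plus[symmetric] by (simp add: o_def add.commute)
  ultimately show ?thesis unfolding e_def by simp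
qed

text \<open>The integral of a periodic function over a shifted cell does not depend on the shift;
  differentiate in the shift at zero.\<close>

lemma integral_partial_derivative_periodic:
  fixes F :: "real ^ 'n \<Rightarrow> real"
  assumes der: "\<And>x. (F has_derivative F' x) (at x)"
    and cont: "continuous_on UNIV (\<lambda>x. F' x (axis i 1))"
    and per: "\<And>x. F (x + axis i 1) = F x"
  shows "integral (cbox 0 1) (\<lambda>x. F' x (axis i 1)) = 0"
proof -
  define e where "e = (axis i 1 :: real ^ 'n)"
  have cF: "continuous_on UNIV F"
    using der by (metis continuous_at_imp_continuous_on has_derivative_continuous)
  have "((\<lambda>s. integral (cbox 0 1) (\<lambda>x. F (x + s *\<^sub>R e))) has_real_derivative
      integral (cbox 0 1) (\<lambda>x. F' (x + 0 *\<^sub>R e) e)) (at 0 within {0..1})"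
  proof (rule leibniz_rule_field_derivative)
    show "((\<lambda>s. F (x + s *\<^sub>R e)) has_real_derivative F' (x + s *\<^sub>R e) e) (at s within {0..1})" for s x
      by (rule has_field_derivative_at_within, rule has_real_derivative_line, rule der)
    show "(\<lambda>x. F (x + s *\<^sub>R e)) integrable_on cbox 0 1" for s
      by (intro integrable_continuous continuous_on_compose2[OF cF] continuous_intros) auto
    show "continuous_on ({0..1} \<times> cbox 0 1) (\<lambda>(s, x). F' (x + s *\<^sub>R e) e)"
      unfolding split_beta e_def
      by (intro continuous_on_compose2[OF cont] continuous_intros) auto
  qed auto
  \<comment> \<open>The shift lemma covers \<open>s\<close> in the unit interval, so the derivatives
    compared here are right derivatives at 0.\<close>
  moreover have "((\<lambda>s. integral (cbox 0 1) (\<lambda>x. F (x + s *\<^sub>R e))) has_real_derivative 0) (at 0 within {0..1})"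
    by (rule has_field_derivative_transform_within[of "\<lambda>_. integral (cbox 0 1) F" _ _ _ 1])
      (auto simp: e_def integral_slab_shift[OF cF per])
  moreover have "at (0::real) within {0..1} \<noteq> bot"
    by (simp add: at_within_Icc_at_right)
  ultimately show ?thesis
    using has_field_derivative_unique unfolding e_def by fastforce
qed

section \<open>Functions of space and time on the open slab\<close>

abbreviation slab :: "real \<Rightarrow> ((real ^ 'n) \<times> real) set" where
  "slab T \<equiv> UNIV \<times> {0<..<T}"

abbreviation dx :: "'n \<Rightarrow> ((real ^ 'n) \<times> real \<Rightarrow> real) \<Rightarrow> (real ^ 'n) \<times> real \<Rightarrow> real" where
  "dx i \<equiv> dirderiv (axis i 1, 0)"

abbreviation dt :: "((real ^ 'n) \<times> real \<Rightarrow> real) \<Rightarrow> (real ^ 'n) \<times> real \<Rightarrow> real" where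
  "dt \<equiv> dirderiv (0, 1)"

lemma open_slab: "open (slab T)"
  by (intro open_Times) auto

lemma Basis_space: "(axis i 1, 0) \<in> (Basis :: ((real ^ 'n) \<times> real) set)"
  and Basis_time: "(0, 1) \<in> (Basis :: ((real ^ 'n) \<times> real) set)"
  by (auto simp: Basis_prod_def Basis_vec_def)

lemma smooth_on_dx: "smooth_on (slab T) f \<Longrightarrow> smooth_on (slab T) (dx i f)"
  and smooth_on_dt: "smooth_on (slab T) f \<Longrightarrow> smooth_on (slab T) (dt f)"
  by (rule smooth_on_dirderiv[OF _ open_slab]; simp add: Basis_space Basis_time)+

lemma smooth_on_axis_deriv:
  fixes H :: "real ^ 'n \<Rightarrow> real"
  shows "smooth_on UNIV H \<Longrightarrow> smooth_on UNIV (dirderiv (axis i 1) H)"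
  by (rule smooth_on_dirderiv) (auto simp: Basis_vec_def)

lemma has_derivative_slice:
  assumes "(f has_derivative f') (at (x, t))"
  shows "((\<lambda>y. f (y, t)) has_derivative (\<lambda>h. f' (h, 0))) (at x)"
proof -
  have "((\<lambda>y. (y, t)) has_derivative (\<lambda>h. (h, 0))) (at x)" by (auto intro!: derivative_eq_intros)
  from has_derivative_compose[OF this assms] show ?thesis .
qed

lemma has_real_derivative_time_line:
  fixes f :: "'a::real_normed_vector \<times> real \<Rightarrow> real"
  assumes "(f has_derivative f') (at (x, t))"
  shows "((\<lambda>s. f (x, s)) has_real_derivative f' (0, 1)) (at t)"
  using has_real_derivative_line[of f f' "(x, 0)" t "(0, 1)"] assms by simp

lemma continuous_on_slice:
  assumes "continuous_on (UNIV \<times> I) f" "t \<in> I"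
  shows "continuous_on A (\<lambda>x. f (x, t))"
  by (rule continuous_on_compose2[OF assms(1)]) (auto intro!: continuous_intros assms(2))

lemma integrable_on_slice:
  fixes f :: "(real ^ 'n) \<times> real \<Rightarrow> real"
  assumes "continuous_on (slab T) f" "t \<in> {0<..<T}"
  shows "(\<lambda>x. f (x, t)) integrable_on cbox 0 1"
  by (intro integrable_continuous continuous_on_slice[OF assms])

lemma integral_slice_time_derivative:
  fixes f :: "(real ^ 'n) \<times> real \<Rightarrow> real"
  assumes der: "\<And>z. z \<in> slab T \<Longrightarrow> (f has_derivative f' z) (at z)"
    and cont: "continuous_on (slab T) (\<lambda>z. f' z (0, 1))" and t: "t \<in> {0<..<T}"
  shows "((\<lambda>t. integral (cbox 0 1) (\<lambda>x. f (x, t))) has_real_derivative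
    integral (cbox 0 1) (\<lambda>x. f' (x, t) (0, 1))) (at t)"
proof -
  have cf: "continuous_on (slab T) f"
    using der by (meson continuous_at_imp_continuous_on has_derivative_continuous)
  have "((\<lambda>t. integral (cbox 0 1) (\<lambda>x. f (x, t))) has_real_derivative
    integral (cbox 0 1) (\<lambda>x. f' (x, t) (0, 1))) (at t within {0<..<T})"
  proof (rule leibniz_rule_field_derivative)
    show "((\<lambda>s. f (x, s)) has_real_derivative f' (x, s) (0, 1)) (at s within {0<..<T})"
      if "s \<in> {0<..<T}" for s x
      by (rule has_field_derivative_at_within, rule has_real_derivative_time_line, rule der) (use that in auto)
    show "(\<lambda>x. f (x, s)) integrable_on cbox 0 1" if "s \<in> {0<..<T}" for s
      by (rule integrable_on_slice[OF cf that])
    show "continuous_on ({0<..<T} \<times> cbox 0 1) (\<lambda>(s, x). f' (x, s) (0, 1))"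
      unfolding split_beta
      by (rule continuous_on_compose2[OF cont]) (auto intro!: continuous_intros)
  qed (use t in auto)
  then show ?thesis using t at_within_open[of t "{0<..<T}"] by simp
qed

text \<open>Where \<open>m\<close> vanishes, \<open>\<phi>\<close> has only a right derivative.
  Since \<open>m\<close> maps the open set \<open>S\<close> into the nonnegative reals, the chain
  rule within \<open>S\<close> sees no other values of \<open>\<phi>\<close>, and a derivative
  within an open set is a full one. It serves for U, P and g.\<close>

lemma has_derivative_compose_nonneg:
  fixes \<phi> \<phi>' :: "real \<Rightarrow> real"
  assumes \<phi>: "\<And>r. r \<ge> 0 \<Longrightarrow> (\<phi> has_real_derivative \<phi>' r) (at r within {0..})"
    and m: "smooth_on S m" "\<And>z. z \<in> S \<Longrightarrow> m z \<ge> 0" and S: "open S" "z \<in> S"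
  shows "((\<lambda>z. \<phi> (m z)) has_derivative (\<lambda>v. \<phi>' (m z) * dirderiv v m z)) (at z)"
proof -
  have "((\<lambda>z. \<phi> (m z)) has_derivative (\<lambda>v. \<phi>' (m z) * dirderiv v m z)) (at z within S)"
  proof (rule has_derivative_in_compose2[where t = "{0..}" and g = \<phi> and g' = "\<lambda>r. (*) (\<phi>' r)"])
    show "(\<phi> has_derivative (*) (\<phi>' r)) (at r within {0..})" if "r \<in> {0..}" for r
      using \<phi>[of r] that by (simp add: has_field_derivative_def)
    show "(m has_derivative (\<lambda>v. dirderiv v m z)) (at z within S)"
      by (rule has_derivative_at_withinI, rule smooth_on_has_derivative; fact)
  qed (use m S in auto)
  then show ?thesis using at_within_open[OF S(2,1)] by simp
qed

text \<open>The integrand is the spatial divergence of the periodic field \<open>\<phi>\<close>(m)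
  c, and each partial derivative integrates to zero. Both integrations by parts are instances:
  \<open>\<phi>\<close> = U with c = b, and \<open>\<phi>\<close> = P with c = b
  \<open>\<theta>\<close> - q.\<close>

lemma integral_divergence_compose:
  fixes m :: "(real ^ 'n) \<times> real \<Rightarrow> real" and \<phi> \<phi>' :: "real \<Rightarrow> real"
  assumes \<phi>: "\<And>r. r \<ge> 0 \<Longrightarrow> (\<phi> has_real_derivative \<phi>' r) (at r within {0..})"
    and \<phi>': "continuous_on {0..} \<phi>'"
    and m: "smooth_on (slab T) m" "\<And>z. z \<in> slab T \<Longrightarrow> m z \<ge> 0"
    and c: "\<And>i. smooth_on (slab T) (c i)"
    and per: "\<And>z i. z \<in> slab T \<Longrightarrow> m (z + (axis i 1, 0)) = m z"
      "\<And>z i j. z \<in> slab T \<Longrightarrow> c j (z + (axis i 1, 0)) = c j z"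
    and t: "t \<in> {0<..<T}"
  shows "integral (cbox 0 1) (\<lambda>x. \<Sum>i\<in>UNIV. \<phi> (m (x, t)) * dx i (c i) (x, t)
    + \<phi>' (m (x, t)) * dx i m (x, t) * c i (x, t)) = 0"
proof -
  have "continuous_on {0..} \<phi>"
    using \<phi> by (auto simp: continuous_on_eq_continuous_within intro: DERIV_continuous)
  then have cont_\<phi>: "continuous_on (slab T) (\<lambda>z. \<phi> (m z))"
    by (rule continuous_on_compose2[OF _ smooth_on_continuous[OF m(1)]]) (use m(2) in auto)
  have cont_\<phi>': "continuous_on (slab T) (\<lambda>z. \<phi>' (m z))"
    by (rule continuous_on_compose2[OF \<phi>' smooth_on_continuous[OF m(1)]]) (use m(2) in auto)
  have cont: "continuous_on (slab T) (\<lambda>z. \<phi> (m z) * dx i (c i) z + \<phi>' (m z) * dx i m z * c i z)" for i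
    by (intro continuous_intros cont_\<phi> cont_\<phi>' smooth_on_continuous smooth_on_dx c m)
  have "integral (cbox 0 1) (\<lambda>x. \<phi> (m (x, t)) * dx i (c i) (x, t) + \<phi>' (m (x, t)) * dx i m (x, t) * c i (x, t)) = 0" for i
  proof (rule integral_partial_derivative_periodic[where F = "\<lambda>x. \<phi> (m (x, t)) * c i (x, t)"
        and F' = "\<lambda>x h. \<phi> (m (x, t)) * dirderiv (h, 0) (c i) (x, t) + \<phi>' (m (x, t)) * dirderiv (h, 0) m (x, t) * c i (x, t)"])
    fix x :: "real ^ 'n"
    have xt: "(x, t) \<in> slab T" using t by simp
    show "((\<lambda>x. \<phi> (m (x, t)) * c i (x, t)) has_derivative
      (\<lambda>h. \<phi> (m (x, t)) * dirderiv (h, 0) (c i) (x, t) + \<phi>' (m (x, t)) * dirderiv (h, 0) m (x, t) * c i (x, t))) (at x)"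
      by (rule has_derivative_slice[where f = "\<lambda>z. \<phi> (m z) * c i z"], rule has_derivative_mult[OF
          has_derivative_compose_nonneg[OF \<phi> m open_slab xt] smooth_on_has_derivative[OF c open_slab xt]])
    show "\<phi> (m (x + axis i 1, t)) * c i (x + axis i 1, t) = \<phi> (m (x, t)) * c i (x, t)"
      using per[OF xt] by simp
  next
    show "continuous_on UNIV (\<lambda>x. \<phi> (m (x, t)) * dx i (c i) (x, t) + \<phi>' (m (x, t)) * dx i m (x, t) * c i (x, t))"
      by (rule continuous_on_slice[OF cont t])
  qed
  then show ?thesis by (subst integral_sum) (auto intro: integrable_on_slice[OF cont t])
qed

section \<open>Evolution of the velocity field and of its divergence\<close>

lemma divergence_material_derivative:
  fixes b q :: "'n \<Rightarrow> (real ^ 'n) \<times> real \<Rightarrow> real"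
  assumes b: "\<And>i. smooth_on (slab T) (b i)" and q: "\<And>i. smooth_on (slab T) (q i)"
    and eq: "\<And>i z. z \<in> slab T \<Longrightarrow> dt (b i) z = (\<Sum>l\<in>UNIV. b l z * dx l (b i) z) - q i z"
    and z: "z \<in> slab T"
  defines "\<theta> \<equiv> \<lambda>z. \<Sum>i\<in>UNIV. dx i (b i) z"
  shows "dt \<theta> z = (\<Sum>i\<in>UNIV. \<Sum>l\<in>UNIV. dx l (b i) z * dx i (b l) z)
    + (\<Sum>l\<in>UNIV. b l z * dx l \<theta> z) - (\<Sum>i\<in>UNIV. dx i (q i) z)"
proof -
  note os = open_slab z
  have "dt \<theta> z = (\<Sum>i\<in>UNIV. dt (dx i (b i)) z)"
    unfolding \<theta>_def by (intro dirderiv_sum[OF _ os] smooth_on_dx b)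
  \<comment> \<open>Where the outer derivative hits the coefficient \<open>b l\<close>, the product
    rule produces tr((Db)^2); where it hits \<open>dx l (b i)\<close>, swapping derivatives gives
    the transport of \<open>\<theta>\<close>.\<close>
  also have "\<dots> = (\<Sum>i\<in>UNIV. (\<Sum>l\<in>UNIV. b l z * dx i (dx l (b i)) z + dx i (b l) z * dx l (b i) z) - dx i (q i) z)"
  proof (intro sum.cong refl)
    fix i
    have "dt (dx i (b i)) z = dx i (dt (b i)) z"
      by (rule dirderiv_commute[OF b os Basis_time Basis_space])
    also have "\<dots> = dirderiv (axis i 1, 0) (\<lambda>z. (\<Sum>l\<in>UNIV. b l z * dx l (b i) z) - q i z) z"
      by (rule dirderiv_cong[OF smooth_on_has_derivative[OF _ os] os eq])
        (intro smooth_on_diff smooth_on_sum smooth_on_mult smooth_on_dx b q)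
    also have "\<dots> = (\<Sum>l\<in>UNIV. dirderiv (axis i 1, 0) (\<lambda>z. b l z * dx l (b i) z) z) - dx i (q i) z"
      by (subst dirderiv_diff[OF _ q os], intro smooth_on_sum smooth_on_mult smooth_on_dx b)
        (subst dirderiv_sum[OF _ os], auto intro: smooth_on_mult smooth_on_dx b)
    also have "(\<Sum>l\<in>UNIV. dirderiv (axis i 1, 0) (\<lambda>z. b l z * dx l (b i) z) z)
      = (\<Sum>l\<in>UNIV. b l z * dx i (dx l (b i)) z + dx i (b l) z * dx l (b i) z)"
      by (intro sum.cong refl dirderiv_mult[OF _ _ os] smooth_on_dx b)
    finally show "dt (dx i (b i)) z = \<dots> - dx i (q i) z" .
  qed
  also have "\<dots> = (\<Sum>i\<in>UNIV. \<Sum>l\<in>UNIV. dx l (b i) z * dx i (b l) z)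
      + (\<Sum>i\<in>UNIV. \<Sum>l\<in>UNIV. b l z * dx i (dx l (b i)) z) - (\<Sum>i\<in>UNIV. dx i (q i) z)"
    by (simp add: sum.distrib sum_subtractf mult.commute)
  also have "(\<Sum>i\<in>UNIV. \<Sum>l\<in>UNIV. b l z * dx i (dx l (b i)) z) = (\<Sum>l\<in>UNIV. b l z * dx l \<theta> z)"
  proof -
    have "dx l \<theta> z = (\<Sum>i\<in>UNIV. dx l (dx i (b i)) z)" for l
      unfolding \<theta>_def by (intro dirderiv_sum[OF _ os] smooth_on_dx b)
    also have "\<dots> l = (\<Sum>i\<in>UNIV. dx i (dx l (b i)) z)" for l
      by (intro sum.cong refl dirderiv_commute[OF b os Basis_space Basis_space])
    finally show ?thesis by (subst sum.swap) (simp only: sum_distrib_left)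
  qed
  finally show ?thesis .
qed

text \<open>As b = DH(w) with w = Du, any derivative of b is A times that derivative of Du. For the
  time derivative, D(u_t) = D(H(w)) - DG = (D^2u) b - DG, and A D^2u = Db turns A (D^2u) b back into
  (Db) b.\<close>

lemma velocity_material_derivative:
  fixes u G :: "(real ^ 'n) \<times> real \<Rightarrow> real" and H :: "real ^ 'n \<Rightarrow> real"
  assumes u: "smooth_on (slab T) u" and G: "smooth_on (slab T) G" and H: "smooth_on UNIV H"
  defines "w \<equiv> \<lambda>z. \<chi> k. dx k u z"
  defines "b \<equiv> \<lambda>i z. dirderiv (axis i 1) H (w z)"
  defines "a \<equiv> \<lambda>i k z. dirderiv (axis k 1) (dirderiv (axis i 1) H) (w z)"
  assumes eq: "\<And>z. z \<in> slab T \<Longrightarrow> dt u z = H (w z) - G z"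
    and z: "z \<in> slab T"
  shows "dx j (b i) z = (\<Sum>k\<in>UNIV. a i k z * dx j (dx k u) z)"
    and "dt (b i) z = (\<Sum>l\<in>UNIV. b l z * dx l (b i) z) - (\<Sum>k\<in>UNIV. a i k z * dx k G z)"
proof -
  note os = open_slab z
  have b: "dirderiv v (b i) z = (\<Sum>k\<in>UNIV. a i k z * dirderiv v (dx k u) z)" for v i
    unfolding b_def a_def w_def
    by (rule dirderiv_compose_vec[OF smooth_on_axis_deriv[OF H] smooth_on_dx[OF u] os])
  show "dx j (b i) z = (\<Sum>k\<in>UNIV. a i k z * dx j (dx k u) z)" by (rule b)
  have "dt (dx k u) z = (\<Sum>l\<in>UNIV. b l z * dx l (dx k u) z) - dx k G z" for k
  proof -
    have "dt (dx k u) z = dx k (dt u) z"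
      by (rule dirderiv_commute[OF u os Basis_time Basis_space])
    also have "\<dots> = dirderiv (axis k 1, 0) (\<lambda>z. H (w z) - G z) z"
      unfolding w_def
      by (rule dirderiv_cong[OF smooth_on_has_derivative[OF _ os] os eq[unfolded w_def]])
        (intro smooth_on_diff smooth_on_compose_vec H smooth_on_dx u G)
    also have "\<dots> = dirderiv (axis k 1, 0) (\<lambda>z. H (w z)) z - dx k G z"
      unfolding w_def by (rule dirderiv_diff[OF _ G os]) (intro smooth_on_compose_vec H smooth_on_dx u)
    also have "dirderiv (axis k 1, 0) (\<lambda>z. H (w z)) z = (\<Sum>l\<in>UNIV. b l z * dx k (dx l u) z)"
      unfolding w_def b_def by (rule dirderiv_compose_vec[OF H smooth_on_dx[OF u] os])
    \<comment> \<open>Symmetry of D^2u turns the gradient of H(Du) into transport of Du along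
      b.\<close>
    also have "\<dots> = (\<Sum>l\<in>UNIV. b l z * dx l (dx k u) z)"
      by (simp add: dirderiv_commute[OF u os Basis_space[of k] Basis_space])
    finally show ?thesis .
  qed
  then have "dt (b i) z = (\<Sum>k\<in>UNIV. \<Sum>l\<in>UNIV. a i k z * (b l z * dx l (dx k u) z)) - (\<Sum>k\<in>UNIV. a i k z * dx k G z)"
    unfolding b by (simp add: right_diff_distrib sum_subtractf sum_distrib_left)
  also have "(\<Sum>k\<in>UNIV. \<Sum>l\<in>UNIV. a i k z * (b l z * dx l (dx k u) z)) = (\<Sum>l\<in>UNIV. b l z * dx l (b i) z)"
    unfolding b sum_distrib_left by (subst sum.swap) (simp add: mult_ac)
  finally show "dt (b i) z = (\<Sum>l\<in>UNIV. b l z * dx l (b i) z) - (\<Sum>k\<in>UNIV. a i k z * dx k G z)" .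
qed

section \<open>Convexity of the internal energy\<close>

text \<open>The calculus part, separated from the structure of the game: only the evolution laws of
  \<open>m\<close> and \<open>b\<close> enter, \<open>q\<close> stands for A D(g(m)), and the sign
  of the final integrand is a hypothesis.\<close>

lemma internal_energy_convex_on_open_interval:
  fixes m :: "(real ^ 'n) \<times> real \<Rightarrow> real" and b q :: "'n \<Rightarrow> (real ^ 'n) \<times> real \<Rightarrow> real"
    and U U' P' :: "real \<Rightarrow> real"
  defines "P \<equiv> \<lambda>r. U' r * r - U r" and "\<theta> \<equiv> \<lambda>z. \<Sum>i\<in>UNIV. dx i (b i) z"
  assumes U: "\<And>r. r \<ge> 0 \<Longrightarrow> (U has_real_derivative U' r) (at r within {0..})"
    and U': "continuous_on {0..} U'"
    and P: "\<And>r. r \<ge> 0 \<Longrightarrow> (P has_real_derivative P' r) (at r within {0..})"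
    and P': "continuous_on {0..} P'"
    and m: "smooth_on (slab T) m" "\<And>z. z \<in> slab T \<Longrightarrow> m z \<ge> 0"
    and b: "\<And>i. smooth_on (slab T) (b i)" and q: "\<And>i. smooth_on (slab T) (q i)"
    and per: "\<And>z i. z \<in> slab T \<Longrightarrow> m (z + (axis i 1, 0)) = m z"
      "\<And>z i j. z \<in> slab T \<Longrightarrow> b j (z + (axis i 1, 0)) = b j z"
      "\<And>z i j. z \<in> slab T \<Longrightarrow> q j (z + (axis i 1, 0)) = q j z"
    and dt_m: "\<And>z. z \<in> slab T \<Longrightarrow> dt m z = (\<Sum>i\<in>UNIV. b i z * dx i m z) + m z * \<theta> z"
    and dt_b: "\<And>i z. z \<in> slab T \<Longrightarrow> dt (b i) z = (\<Sum>l\<in>UNIV. b l z * dx l (b i) z) - q i z"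
    and nonneg: "\<And>z. z \<in> slab T \<Longrightarrow> 0 \<le> (m z * P' (m z) - P (m z)) * (\<theta> z)\<^sup>2
      + P (m z) * (\<Sum>i\<in>UNIV. \<Sum>l\<in>UNIV. dx l (b i) z * dx i (b l) z)
      + P' (m z) * (\<Sum>i\<in>UNIV. dx i m z * q i z)"
  shows "convex_on {0<..<T} (\<lambda>t. integral (cbox 0 1) (\<lambda>x. U (m (x, t))))"
proof -
  have \<theta>: "smooth_on (slab T) \<theta>"
    unfolding \<theta>_def by (intro smooth_on_sum smooth_on_dx b)
  have \<theta>_per: "\<theta> (z + (axis i 1, 0)) = \<theta> z" if "z \<in> slab T" for z i
    unfolding \<theta>_def
    by (intro sum.cong refl dirderiv_periodic[OF b open_slab that _ per(2)]) auto
  have cont_compose: "continuous_on (slab T) (\<lambda>z. \<phi> (m z))" if "continuous_on {0..} \<phi>" for \<phi> :: "real \<Rightarrow> real"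
    by (rule continuous_on_compose2[OF that smooth_on_continuous[OF m(1)]]) (use m(2) in auto)
  have cP: "continuous_on {0..} P"
    using P by (auto simp: continuous_on_eq_continuous_within intro: DERIV_continuous)
  have cU: "continuous_on {0..} U"
    using U by (auto simp: continuous_on_eq_continuous_within intro: DERIV_continuous)
  note cont = continuous_intros cont_compose U' P' cU cP smooth_on_continuous[OF m(1)]
    smooth_on_continuous[OF smooth_on_dx[OF m(1)]] smooth_on_continuous[OF smooth_on_dt[OF m(1)]]
    smooth_on_continuous[OF smooth_on_dx[OF b]] smooth_on_continuous[OF q]
    smooth_on_continuous[OF \<theta>] smooth_on_continuous[OF smooth_on_dt[OF \<theta>]]
  have split: "integral (cbox 0 1) (\<lambda>x. f (x, t)) = integral (cbox 0 1) (\<lambda>x. g (x, t))"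
    if "continuous_on (slab T) f" "continuous_on (slab T) g" "t \<in> {0<..<T}"
      "integral (cbox 0 1) (\<lambda>x. f (x, t) - g (x, t)) = 0" for f g :: "(real ^ 'n) \<times> real \<Rightarrow> real" and t
    using that integral_diff[OF integrable_on_slice[of T f t] integrable_on_slice[of T g t]] by simp
  define K where "K t = integral (cbox 0 1) (\<lambda>x. P (m (x, t)) * \<theta> (x, t))" for t
  define f' where "f' z = P (m z) * dt \<theta> z + P' (m z) * dt m z * \<theta> z" for z
  show ?thesis
  proof (rule f''_ge0_imp_convex)
    fix t assume t: "t \<in> {0<..<T}"
    have "((\<lambda>t. integral (cbox 0 1) (\<lambda>x. U (m (x, t)))) has_real_derivative
        integral (cbox 0 1) (\<lambda>x. U' (m (x, t)) * dt m (x, t))) (at t)"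
      by (rule integral_slice_time_derivative[OF has_derivative_compose_nonneg[OF U m open_slab] _ t])
        (auto intro!: cont simp del: mem_Sigma_iff)
    also have "integral (cbox 0 1) (\<lambda>x. U' (m (x, t)) * dt m (x, t)) = K t"
      unfolding K_def
    proof (rule split[OF _ _ t])
      show "continuous_on (slab T) (\<lambda>z. U' (m z) * dt m z)" "continuous_on (slab T) (\<lambda>z. P (m z) * \<theta> z)"
        by (intro cont)+
      \<comment> \<open>The difference is div(U(m) b).\<close>
      have "U' (m z) * dt m z - P (m z) * \<theta> z
        = (\<Sum>i\<in>UNIV. U (m z) * dx i (b i) z + U' (m z) * dx i m z * b i z)" if "z \<in> slab T" for z
      proof -
        have "U' (m z) * dt m z - P (m z) * \<theta> z = U (m z) * \<theta> z + U' (m z) * (\<Sum>i\<in>UNIV. b i z * dx i m z)"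
          unfolding dt_m[OF that] by (simp add: P_def algebra_simps)
        then show ?thesis by (simp add: \<theta>_def sum.distrib sum_distrib_left mult_ac)
      qed
      then have "integral (cbox 0 1) (\<lambda>x. U' (m (x, t)) * dt m (x, t) - P (m (x, t)) * \<theta> (x, t))
        = integral (cbox 0 1) (\<lambda>x. \<Sum>i\<in>UNIV. U (m (x, t)) * dx i (b i) (x, t) + U' (m (x, t)) * dx i m (x, t) * b i (x, t))"
        using t by (intro integral_cong) auto
      also have "\<dots> = 0"
        by (rule integral_divergence_compose[OF U U' m b per(1,2) t])
      finally show "integral (cbox 0 1) (\<lambda>x. U' (m (x, t)) * dt m (x, t) - P (m (x, t)) * \<theta> (x, t)) = 0" .
    qed
    finally show "((\<lambda>t. integral (cbox 0 1) (\<lambda>x. U (m (x, t)))) has_real_derivative K t) (at t)" .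
  next
    fix t assume t: "t \<in> {0<..<T}"
    have der: "((\<lambda>z. P (m z) * \<theta> z) has_derivative
        (\<lambda>v. P (m z) * dirderiv v \<theta> z + P' (m z) * dirderiv v m z * \<theta> z)) (at z)" if "z \<in> slab T" for z
      by (rule has_derivative_mult[OF has_derivative_compose_nonneg[OF P m open_slab that]
            smooth_on_has_derivative[OF \<theta> open_slab that]])
    show "(K has_real_derivative integral (cbox 0 1) (\<lambda>x. f' (x, t))) (at t)"
      unfolding K_def[abs_def] f'_def
      by (rule integral_slice_time_derivative[OF der _ t]) (assumption, intro cont)
    \<comment> \<open>Chosen so that \<open>f' - N\<close> is div(P(m) c). The divergence of b
      \<open>\<theta>\<close> contributes b . D\<open>\<theta>\<close> + \<open>\<theta>\<close>^2;
      the extra square is what turns m P' into m P' - P in \<open>N\<close>.\<close>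
    define c where "c i z = b i z * \<theta> z - q i z" for i z
    have c: "smooth_on (slab T) (c i)" for i
      unfolding c_def by (intro smooth_on_diff smooth_on_mult b \<theta> q)
    have dx_c: "dx i (c i) z = b i z * dx i \<theta> z + dx i (b i) z * \<theta> z - dx i (q i) z" if z: "z \<in> slab T" for i z
    proof -
      have "dx i (c i) z = dirderiv (axis i 1, 0) (\<lambda>z. b i z * \<theta> z) z - dx i (q i) z"
        unfolding c_def by (rule dirderiv_diff[OF smooth_on_mult[OF b \<theta>] q open_slab z])
      then show ?thesis by (simp add: dirderiv_mult[OF b \<theta> open_slab z])
    qed
    define N where "N z = (m z * P' (m z) - P (m z)) * (\<theta> z)\<^sup>2
      + P (m z) * (\<Sum>i\<in>UNIV. \<Sum>l\<in>UNIV. dx l (b i) z * dx i (b l) z)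
      + P' (m z) * (\<Sum>i\<in>UNIV. dx i m z * q i z)" for z
    have "integral (cbox 0 1) (\<lambda>x. f' (x, t)) = integral (cbox 0 1) (\<lambda>x. N (x, t))"
    proof (rule split[OF _ _ t])
      show "continuous_on (slab T) f'" "continuous_on (slab T) N"
        unfolding f'_def N_def by (intro cont)+
      have "f' z - N z = (\<Sum>i\<in>UNIV. P (m z) * dx i (c i) z + P' (m z) * dx i m z * c i z)" if z: "z \<in> slab T" for z
      proof -
        have sum_eq: "(\<Sum>i\<in>UNIV. P (m z) * dx i (c i) z + P' (m z) * dx i m z * c i z)
          = P (m z) * ((\<Sum>i\<in>UNIV. b i z * dx i \<theta> z) + \<theta> z * \<theta> z - (\<Sum>i\<in>UNIV. dx i (q i) z))
            + P' (m z) * (\<theta> z * (\<Sum>i\<in>UNIV. b i z * dx i m z) - (\<Sum>i\<in>UNIV. dx i m z * q i z))"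
          unfolding dx_c[OF z] c_def
          by (simp add: \<theta>_def sum.distrib sum_subtractf sum_distrib_left sum_distrib_right algebra_simps)
        have dt_\<theta>: "dt \<theta> z = (\<Sum>i\<in>UNIV. \<Sum>l\<in>UNIV. dx l (b i) z * dx i (b l) z)
            + (\<Sum>l\<in>UNIV. b l z * dx l \<theta> z) - (\<Sum>i\<in>UNIV. dx i (q i) z)"
          unfolding \<theta>_def by (rule divergence_material_derivative[OF b q dt_b z])
        show ?thesis
          unfolding f'_def N_def dt_m[OF z] dt_\<theta> sum_eq by (simp add: algebra_simps power2_eq_square)
      qed
      then have "integral (cbox 0 1) (\<lambda>x. f' (x, t) - N (x, t))
        = integral (cbox 0 1) (\<lambda>x. \<Sum>i\<in>UNIV. P (m (x, t)) * dx i (c i) (x, t) + P' (m (x, t)) * dx i m (x, t) * c i (x, t))"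
        using t by (intro integral_cong) auto
      also have "\<dots> = 0"
        by (rule integral_divergence_compose[OF P P' m c per(1) _ t])
          (simp_all add: c_def per \<theta>_per del: mem_Sigma_iff)
      finally show "integral (cbox 0 1) (\<lambda>x. f' (x, t) - N (x, t)) = 0" .
    qed
    also have "\<dots> \<ge> 0"
    proof (rule integral_nonneg)
      show "(\<lambda>x. N (x, t)) integrable_on cbox 0 1"
        by (rule integrable_on_slice[OF _ t]) (unfold N_def, intro cont)
      show "0 \<le> N (x, t)" for x using nonneg[of "(x, t)"] t by (simp add: N_def)
    qed
    finally show "integral (cbox 0 1) (\<lambda>x. f' (x, t)) \<ge> 0" .
  qed simp
qed

theorem theorem1p1:
  fixes T :: real and g U :: "real \<Rightarrow> real"
    and H :: "real ^ 'n \<Rightarrow> real"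
    and u m :: "real ^ 'n \<Rightarrow> real \<Rightarrow> real"
  assumes T_pos: "T > 0"
    and g_smooth: "smooth_on {0..} g"
    and g_mono: "mono_on {0..} g"
    and H_smooth: "smooth_on UNIV H"
    and H_convex: "convex_on UNIV H"
    and u_smooth: "smooth_on (UNIV \<times> {0..T}) (\<lambda>(x, t). u x t)"
    and m_smooth: "smooth_on (UNIV \<times> {0..T}) (\<lambda>(x, t). m x t)"
    and u_periodic: "\<And>t. t \<in> {0..T} \<Longrightarrow> Zd_periodic (\<lambda>x. u x t)"
    and m_periodic: "\<And>t. t \<in> {0..T} \<Longrightarrow> Zd_periodic (\<lambda>x. m x t)"
    and m_nonneg: "\<And>x t. t \<in> {0..T} \<Longrightarrow> m x t \<ge> 0"
    and hamilton_jacobi: "\<And>x t. t \<in> {0<..<T} \<Longrightarrow>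
      - deriv (\<lambda>s. u x s) t + H (grad (\<lambda>y. u y t) x) = g (m x t)"
    and continuity: "\<And>x t. t \<in> {0<..<T} \<Longrightarrow>
      deriv (\<lambda>s. m x s) t
        - divergence (\<lambda>y. m y t *\<^sub>R grad H (grad (\<lambda>z. u z t) y)) x = 0"
    and U_C1: "Ck_on 1 {0..} U"
    and P_C1: "Ck_on 1 {0..} (pressure U)"
    and P_nonneg: "\<And>z. z \<ge> 0 \<Longrightarrow> pressure U z \<ge> 0"
    and P_mono: "mono_on {0<..} (\<lambda>z. pressure U z / z powr (1 - 1 / real CARD('n)))"
  shows "convex_on {0..T} (\<lambda>t. torus_integral (\<lambda>x. U (m x t)))"
proof (rule convex_on_closed_interval[OF _ _ T_pos])
  obtain U' where U': "\<And>r. r \<ge> 0 \<Longrightarrow> (U has_real_derivative U' r) (at r within {0..})"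
    "continuous_on {0..} U'"
    using Ck_on_1_real_derivative[OF U_C1] by (metis atLeast_iff)
  \<comment> \<open>One-sided derivatives on the half-line are unique, including at 0, so the
    derivative inside \<open>pressure\<close> is \<open>U'\<close>.\<close>
  have pressure: "pressure U r = U' r * r - U r" if "r \<ge> 0" for r
    unfolding pressure_def
    by (subst vector_derivative_within[OF at_within_atLeast_ne_bot[OF that]])
      (use U'(1)[OF that] in \<open>auto simp: has_real_derivative_iff_has_vector_derivative\<close>)
  have "Ck_on 1 {0..} (\<lambda>r. U' r * r - U r)"
    by (rule Ck_on_cong[OF P_C1]) (simp add: pressure)
  from Ck_on_1_real_derivative[OF this] obtain P' where
    P': "\<And>r. r \<ge> 0 \<Longrightarrow> ((\<lambda>r. U' r * r - U r) has_real_derivative P' r) (at r within {0..})"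
      "continuous_on {0..} P'"
    by (metis atLeast_iff)
  have P_mono': "mono_on {0<..} (\<lambda>r. (U' r * r - U r) / r powr (1 - 1 / real CARD('n)))"
    using P_mono by (simp add: mono_on_def pressure)
  have P_nonneg': "U' r * r - U r \<ge> 0" if "r \<ge> 0" for r
    using P_nonneg[OF that] by (simp add: pressure[OF that])
  have exponent: "1 - 1 / real CARD('n) \<ge> 0" by simp
  have P: "(1 - 1 / real CARD('n)) * (U' r * r - U r) \<le> r * P' r" "P' r \<ge> 0" if "r \<ge> 0" for r
    by (rule power_growth_derivative[OF P' P_nonneg' P_mono' exponent that]; assumption)+

  have cU: "continuous_on {0..} U"
    using smooth_on_continuous U_C1 Ck_on_SucD[of 0 "{0..}" U] by simp
  \<comment> \<open>The pair is swapped because the parameter, here time, comes first in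
    \<open>integral_continuous_on_param\<close>.\<close>
  have "continuous_on ({0..T} \<times> cbox 0 1) (\<lambda>z. U (case (snd z, fst z) of (x, t) \<Rightarrow> m x t))"
    by (rule continuous_on_compose2[OF cU], rule continuous_on_compose2[OF smooth_on_continuous[OF m_smooth]])
      (auto intro!: continuous_intros m_nonneg)
  then show "continuous_on {0..T} (\<lambda>t. torus_integral (\<lambda>x. U (m x t)))"
    unfolding torus_integral_def by (intro integral_continuous_on_param) (simp add: split_beta)

  define v where "v = (\<lambda>(x, t). u x t)"
  have v_app: "v (x, t) = u x t" for x t by (simp add: v_def)
  define \<mu> where "\<mu> = (\<lambda>(x, t). m x t)"
  \<comment> \<open>On the open slab the derivatives of the hypotheses, taken within the closed one,
    become full derivatives.\<close>
  have sub: "slab T \<subseteq> (UNIV :: (real ^ 'n) set) \<times> {0..T}" by auto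
  have v: "smooth_on (slab T) v" and \<mu>: "smooth_on (slab T) \<mu>"
    unfolding v_def \<mu>_def using u_smooth m_smooth sub by (blast intro: smooth_on_subset)+
  have \<mu>_nonneg: "\<mu> z \<ge> 0" if "z \<in> slab T" for z
    using that m_nonneg by (auto simp: \<mu>_def)
  have shift: "z + (axis i 1, 0) \<in> slab T" if "z \<in> slab T" for z :: "(real ^ 'n) \<times> real" and i
    using that by auto
  have axis_int: "\<forall>j. axis i 1 $ j \<in> (\<int> :: real set)" for i :: 'n by (auto simp: axis_def)
  have v_per: "v (z + (axis i 1, 0)) = v z" and \<mu>_per: "\<mu> (z + (axis i 1, 0)) = \<mu> z" if "z \<in> slab T" for z i
    using that u_periodic m_periodic axis_int[of i] by (auto simp: v_def \<mu>_def Zd_periodic_def)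

  define w where "w z = (\<chi> k. dx k v z)" for z
  define b where "b i z = dirderiv (axis i 1) H (w z)" for i z
  define a where "a i k z = dirderiv (axis k 1) (dirderiv (axis i 1) H) (w z)" for i k z
  \<comment> \<open>By the Hamilton--Jacobi equation \<open>G = g \<circ> m\<close>; defined this way, its smoothness needs no
    higher-order chain rule for \<open>g\<close>, which is only given on \<open>[0,\<infinity>)\<close>.\<close>
  define G where "G z = H (w z) - dt v z" for z
  define q where "q i z = (\<Sum>k\<in>UNIV. a i k z * dx k G z)" for i z
  define \<theta> where "\<theta> z = (\<Sum>i\<in>UNIV. dx i (b i) z)" for z
  have G: "smooth_on (slab T) G"
    unfolding G_def w_def by (intro smooth_on_diff smooth_on_compose_vec H_smooth smooth_on_dx smooth_on_dt v)
  have b: "smooth_on (slab T) (b i)" for i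
    unfolding b_def w_def by (intro smooth_on_compose_vec smooth_on_axis_deriv H_smooth smooth_on_dx v)
  have a: "smooth_on (slab T) (a i k)" for i k
    unfolding a_def w_def by (intro smooth_on_compose_vec smooth_on_axis_deriv H_smooth smooth_on_dx v)
  have q: "smooth_on (slab T) (q i)" for i
    unfolding q_def by (intro smooth_on_sum smooth_on_mult a smooth_on_dx G)
  have w_per: "w (z + (axis i 1, 0)) = w z" if "z \<in> slab T" for z i
    unfolding w_def by (simp add: dirderiv_periodic[OF v open_slab that shift v_per] del: mem_Sigma_iff)
  have G_per: "G (z + (axis i 1, 0)) = G z" if "z \<in> slab T" for z i
    unfolding G_def by (simp add: w_per[OF that] dirderiv_periodic[OF v open_slab that shift v_per] del: mem_Sigma_iff)
  have b_per: "b j (z + (axis i 1, 0)) = b j z" if "z \<in> slab T" for z i j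
    unfolding b_def by (simp add: w_per[OF that])
  have q_per: "q j (z + (axis i 1, 0)) = q j z" if "z \<in> slab T" for z i j
    unfolding q_def a_def w_per[OF that]
    by (simp add: dirderiv_periodic[OF G open_slab that shift G_per] del: mem_Sigma_iff)

  \<comment> \<open>The equations are stated with derivatives of slices; these steps rewrite them as
    partial derivatives of the joint functions \<open>v\<close> and \<open>\<mu>\<close>.\<close>
  have deriv_time: "deriv (\<lambda>s. f (x, s)) t = dt f (x, t)"
    if "smooth_on (slab T) f" "t \<in> {0<..<T}" for f :: "(real ^ 'n) \<times> real \<Rightarrow> real" and x t
    by (rule DERIV_imp_deriv, rule has_real_derivative_time_line,
        rule smooth_on_has_derivative[OF that(1) open_slab]) (use that in auto)
  have grad_slice: "grad (\<lambda>y. u y t) x = w (x, t)" if "t \<in> {0<..<T}" for x t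
  proof -
    have "(v has_derivative (\<lambda>h. dirderiv h v (x, t))) (at (x, t))"
      by (rule smooth_on_has_derivative[OF v open_slab]) (use that in auto)
    from frechet_derivative_at[OF has_derivative_slice[OF this]]
    have "frechet_derivative (\<lambda>y. u y t) (at x) = (\<lambda>h. dirderiv (h, 0) v (x, t))"
      by (simp only: v_app)
    then show ?thesis by (simp add: grad_def w_def)
  qed
  have G_eq: "G z = g (\<mu> z)" if z: "z \<in> slab T" for z
  proof -
    obtain x t where xt: "z = (x, t)" "t \<in> {0<..<T}" using z by auto
    show ?thesis using hamilton_jacobi[OF xt(2), of x] deriv_time[OF v xt(2), of x]
      by (simp add: xt(1) G_def \<mu>_def grad_slice[OF xt(2)] v_def)
  qed
  have dt_\<mu>: "dt \<mu> z = (\<Sum>i\<in>UNIV. b i z * dx i \<mu> z) + \<mu> z * \<theta> z" if z: "z \<in> slab T" for z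
  proof -
    obtain x t where xt: "z = (x, t)" "t \<in> {0<..<T}" using z by auto
    have "((\<lambda>y. \<chi> i. \<mu> (y, t) * b i (y, t)) has_derivative
        (\<lambda>h. \<chi> i. \<mu> (x, t) * dirderiv (h, 0) (b i) (x, t) + dirderiv (h, 0) \<mu> (x, t) * b i (x, t))) (at x)"
      by (intro has_derivative_vec has_derivative_slice[where f = "\<lambda>z. \<mu> z * b i z" for i]
          has_derivative_mult smooth_on_has_derivative[OF \<mu> open_slab] smooth_on_has_derivative[OF b open_slab] z[unfolded xt(1)])
    moreover have "m y t *\<^sub>R grad H (grad (\<lambda>z. u z t) y) = (\<chi> i. \<mu> (y, t) * b i (y, t))" for y
      by (simp add: grad_slice[OF xt(2)] \<mu>_def b_def grad_def dirderiv_def vec_eq_iff)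
    ultimately have "divergence (\<lambda>y. m y t *\<^sub>R grad H (grad (\<lambda>z. u z t) y)) x
        = (\<Sum>i\<in>UNIV. \<mu> (x, t) * dx i (b i) (x, t) + dx i \<mu> (x, t) * b i (x, t))"
      unfolding divergence_def by (simp add: frechet_derivative_at[symmetric])
    then show ?thesis
      using continuity[OF xt(2), of x] deriv_time[OF \<mu> xt(2), of x]
      by (simp add: xt(1) \<mu>_def \<theta>_def sum.distrib sum_distrib_left mult.commute)
  qed
  have dt_v: "dt v z = H (w z) - G z" for z by (simp add: G_def)
  note b_deriv = velocity_material_derivative[OF v G H_smooth, folded w_def, folded b_def a_def, OF dt_v]

  obtain g' where g': "\<And>r. r \<ge> 0 \<Longrightarrow> (g has_real_derivative g' r) (at r within {0..})"
    using Ck_on_1_real_derivative[OF smooth_onD[OF g_smooth]] by (metis atLeast_iff)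
  have g'_nonneg: "g' r \<ge> 0" if "r \<ge> 0" for r
    by (rule mono_on_within_deriv_nonneg[OF g_mono g'[OF that]])
      (use that at_within_atLeast_ne_bot[OF that] in auto)
  \<comment> \<open>Only here does the structure of \<open>G\<close> matter: its gradient is a
    nonnegative multiple of that of \<open>\<mu>\<close>, so pairing \<open>q\<close> with the
    gradient of \<open>\<mu>\<close> gives a Hessian quadratic form.\<close>
  have dx_G: "dx k G z = g' (\<mu> z) * dx k \<mu> z" if z: "z \<in> slab T" for k z
    by (rule dirderiv_cong[OF has_derivative_compose_nonneg[OF g' \<mu> \<mu>_nonneg open_slab z] open_slab z G_eq])
  have psd: "(\<Sum>i\<in>UNIV. \<Sum>j\<in>UNIV. x i * x j * a i j z) \<ge> 0" for x z
    unfolding a_def by (rule convex_hessian_psd[OF H_smooth H_convex])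
  have a_sym: "a i j z = a j i z" for i j z
    unfolding a_def by (rule dirderiv_commute[OF H_smooth]) (auto simp: Basis_vec_def)

  have "convex_on {0<..<T} (\<lambda>t. integral (cbox 0 1) (\<lambda>x. U (\<mu> (x, t))))"
  proof (rule internal_energy_convex_on_open_interval[OF U' P' \<mu> \<mu>_nonneg b q \<mu>_per b_per q_per dt_\<mu>[unfolded \<theta>_def]])
    fix i and z :: "(real ^ 'n) \<times> real" assume z: "z \<in> slab T"
    show "dt (b i) z = (\<Sum>l\<in>UNIV. b l z * dx l (b i) z) - q i z"
      unfolding q_def by (rule b_deriv(2)[OF z])
  next
    fix z :: "(real ^ 'n) \<times> real" assume z: "z \<in> slab T"
    define r where "r = \<mu> z"
    have r: "r \<ge> 0" unfolding r_def by (rule \<mu>_nonneg[OF z])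
    define tr where "tr = (\<Sum>i\<in>UNIV. \<Sum>l\<in>UNIV. dx l (b i) z * dx i (b l) z)"
    \<comment> \<open>The trace inequality for Db = A D^2u, with the Hessian of \<open>v\<close> as
      the symmetric factor.\<close>
    have "(\<theta> z)\<^sup>2 / real CARD('n) \<le> tr"
      unfolding \<theta>_def tr_def b_deriv(1)[OF z]
      by (rule trace_square_psd_sym[OF a_sym psd dirderiv_commute[OF v open_slab z Basis_space Basis_space]])
    then have "(U' r * r - U r) * ((\<theta> z)\<^sup>2 / real CARD('n)) \<le> (U' r * r - U r) * tr"
      by (rule mult_left_mono[OF _ P_nonneg'[OF r]])
    moreover have "(1 - 1 / real CARD('n)) * (U' r * r - U r) * (\<theta> z)\<^sup>2 \<le> r * P' r * (\<theta> z)\<^sup>2"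
      by (rule mult_right_mono[OF P(1)[OF r]]) simp
    \<comment> \<open>With P = U' r - U at \<open>r\<close>: the growth condition bounds the first
      term below by -P \<open>\<theta>\<close>^2/d, and the trace inequality bounds the second below
      by P \<open>\<theta>\<close>^2/d.\<close>
    ultimately have "0 \<le> (r * P' r - (U' r * r - U r)) * (\<theta> z)\<^sup>2 + (U' r * r - U r) * tr"
      by (simp add: algebra_simps diff_divide_distrib)
    moreover have "(\<Sum>i\<in>UNIV. dx i \<mu> z * q i z) = g' r * (\<Sum>i\<in>UNIV. \<Sum>k\<in>UNIV. dx i \<mu> z * dx k \<mu> z * a i k z)"
      unfolding q_def dx_G[OF z] r_def by (simp add: sum_distrib_left mult_ac)
    then have "0 \<le> P' r * (\<Sum>i\<in>UNIV. dx i \<mu> z * q i z)"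
      using psd[of "\<lambda>i. dx i \<mu> z" z] g'_nonneg[OF r] P(2)[OF r] by simp
    ultimately show "0 \<le> (\<mu> z * P' (\<mu> z) - (U' (\<mu> z) * \<mu> z - U (\<mu> z))) * (\<Sum>i\<in>UNIV. dx i (b i) z)\<^sup>2
      + (U' (\<mu> z) * \<mu> z - U (\<mu> z)) * (\<Sum>i\<in>UNIV. \<Sum>l\<in>UNIV. dx l (b i) z * dx i (b l) z)
      + P' (\<mu> z) * (\<Sum>i\<in>UNIV. dx i \<mu> z * q i z)"
      unfolding \<theta>_def tr_def r_def by linarith
  qed
  then show "convex_on {0<..<T} (\<lambda>t. torus_integral (\<lambda>x. U (m x t)))"
    by (simp add: torus_integral_def \<mu>_def)
qed

end
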